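(* Let $n\ge1$ and let $\mathcal{L}$ be the vertex labeling of the linear representation of some linked cycle on $[n]$, and let $LC_n(\mathcal{L})$ be the set of linked cycles on $[n]$ whose linear representation has vertex labeling $\mathcal{L}$. Then $$\sum_{\hat\pi\in LC_n(\mathcal{L})}x^{cr(\hat\pi)}y^{ne(\hat\pi)}=\sum_{\hat\pi\in LC_n(\mathcal{L})}x^{ne(\hat\pi)}y^{cr(\hat\pi)},$$ i.e. $cr$ and $ne$ have a symmetric joint distribution over $LC_n(\mathcal{L})$.
   Context: Two finite sets of integers $E,F$ are nearly disjoint if for every $i\in E\cap F$ either ($i=\min(E)$, $|E|>1$, $i\ne\min(F)$) or ($i=\min(F)$, $|F|>1$, $i\ne\min(E)$). A linked partition of $[n]$ is a set of nonempty subsets (blocks) of $[n]$ with union $[n]$, any two distinct blocks nearly disjoint; each element lies in one or two blocks (singly/doubly covered). A linked cycle on $[n]$ is a linked partition of $[n]$ with a cyclic arrangement of each block; a cycle is written $(i_1i_2\dots i_t)$ with $i_1$ its minimum. Linear representation of a linked cycle $\hat\pi$: for each $i\in[n]$ create vertices: if $i$ is singly covered and the minimum of its cycle, of size $k+1$, create $i^{(1)},\dots,i^{(k)}$ if $k\ge1$, and a single isolated vertex $i^{(1)}$ if $k=0$; if $i$ is singly covered and not the minimum of its cycle, create $i^{(0)}$; if $i$ is doubly covered and the minimum of a cycle of size $k+1$, create $i^{(0)},i^{(1)},\dots,i^{(k)}$. Vertices lie on a line ordered by $i$, then by superscript. For each cycle $(i_1\dots i_t)$, $t\ge2$, draw arcs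 $(i_1^{(j)},i_{t+1-j}^{(0)})$, $j=1,\dots,t-1$. The vertex labeling is the left-to-right sequence of vertex labels. A $k$-crossing is a set of $k$ arcs $(x_1,y_1),\dots,(x_k,y_k)$ whose endpoints appear in the order $x_1,\dots,x_k,y_1,\dots,y_k$; a $k$-nesting is one whose endpoints appear in the order $x_1,\dots,x_k,y_k,\dots,y_1$. $cr(\hat\pi)$ (resp. $ne(\hat\pi)$) is the largest $k$ such that $\hat\pi$ has a $k$-crossing (resp. $k$-nesting). *)

theory Defs
  imports Main "HOL-Library.Product_Lexorder"
begin

definition nearly_disjoint :: "nat set \<Rightarrow> nat set \<Rightarrow> bool" where
  "nearly_disjoint E F \<longleftrightarrow>
     (\<forall>i \<in> E \<inter> F. (i = Min E \<and> card E > 1 \<and> i \<noteq> Min F) \<or>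
                   (i = Min F \<and> card F > 1 \<and> i \<noteq> Min E))"

definition linked_partition :: "nat \<Rightarrow> nat set set \<Rightarrow> bool" where
  "linked_partition n P \<longleftrightarrow>
     (\<forall>B \<in> P. B \<noteq> {} \<and> B \<subseteq> {1..n}) \<and> \<Union>P = {1..n} \<and>
     (\<forall>E \<in> P. \<forall>F \<in> P. E \<noteq> F \<longrightarrow> nearly_disjoint E F) \<and>
     (\<forall>i \<in> {1..n}. card {B \<in> P. i \<in> B} \<in> {1, 2})"

text \<open>A cycle is written as a list (i_1 ... i_t) of distinct elements with i_1 its minimum.
  A linked cycle on [n] is a set of cycles whose underlying blocks form a linked
  partition of [n] (each block carrying exactly one cyclic arrangement).\<close>
definition linked_cycle :: "nat \<Rightarrow> nat list set \<Rightarrow> bool" where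
  "linked_cycle n C \<longleftrightarrow>
     finite C \<and>
     (\<forall>c \<in> C. c \<noteq> [] \<and> distinct c \<and> hd c = Min (set c)) \<and>
     inj_on set C \<and>
     linked_partition n (set ` C)"

definition cover_count :: "nat list set \<Rightarrow> nat \<Rightarrow> nat" where
  "cover_count C i = card {c \<in> C. i \<in> set c}"

text \<open>Vertices of the linear representation: vertex i^(j) is the pair (i, j);
  vertices are ordered lexicographically (by i, then by superscript).\<close>
definition lr_vertices :: "nat \<Rightarrow> nat list set \<Rightarrow> (nat \<times> nat) set" where
  "lr_vertices n C = {(i, j). i \<in> {1..n} \<and>
     (if cover_count C i = 1 then
        (if (\<exists>c \<in> C. hd c = i) then
           (let k = length (THE c. c \<in> C \<and> i \<in> set c) - 1 in
              if k \<ge> 1 then 1 \<le> j \<and> j \<le> k else j = 1)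
         else j = 0)
      else
        (\<exists>c \<in> C. hd c = i \<and> j \<le> length c - 1))}"

text \<open>Arcs (i_1^(j), i_(t+1-j)^(0)), j = 1..t-1, for each cycle (i_1 ... i_t), t >= 2.
  With 0-based list indexing, i_(t+1-j) is c ! (t - j).\<close>
definition lr_arcs :: "nat list set \<Rightarrow> ((nat \<times> nat) \<times> (nat \<times> nat)) set" where
  "lr_arcs C = {((hd c, j), (c ! (length c - j), 0)) | c j.
       c \<in> C \<and> length c \<ge> 2 \<and> 1 \<le> j \<and> j \<le> length c - 1}"

definition vertex_labeling :: "nat \<Rightarrow> nat list set \<Rightarrow> (nat \<times> nat) list" where
  "vertex_labeling n C = sorted_list_of_set (lr_vertices n C)"

definition has_k_crossing :: "(('v::linorder) \<times> 'v) set \<Rightarrow> nat \<Rightarrow> bool" where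
  "has_k_crossing A k \<longleftrightarrow> (\<exists>x y :: nat \<Rightarrow> 'v.
     (\<forall>m < k. (x m, y m) \<in> A) \<and>
     (\<forall>m. Suc m < k \<longrightarrow> x m < x (Suc m) \<and> y m < y (Suc m)) \<and>
     (0 < k \<longrightarrow> x (k - 1) < y 0))"

definition has_k_nesting :: "(('v::linorder) \<times> 'v) set \<Rightarrow> nat \<Rightarrow> bool" where
  "has_k_nesting A k \<longleftrightarrow> (\<exists>x y :: nat \<Rightarrow> 'v.
     (\<forall>m < k. (x m, y m) \<in> A) \<and>
     (\<forall>m. Suc m < k \<longrightarrow> x m < x (Suc m) \<and> y (Suc m) < y m) \<and>
     (0 < k \<longrightarrow> x (k - 1) < y (k - 1)))"

definition cr :: "nat list set \<Rightarrow> nat" where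
  "cr C = Max {k. has_k_crossing (lr_arcs C) k}"

definition ne :: "nat list set \<Rightarrow> nat" where
  "ne C = Max {k. has_k_nesting (lr_arcs C) k}"

definition LC :: "nat \<Rightarrow> (nat \<times> nat) list \<Rightarrow> nat list set set" where
  "LC n L = {C. linked_cycle n C \<and> vertex_labeling n C = L}"

end

theory Submission
  imports Defs
begin

text \<open>
  A linked cycle with given vertex labeling is the same as a matching of its vertices by arcs; the
  closers are the vertices with superscript 0, and singletons correspond to unmatched vertices. It
  therefore suffices to find an involution on matchings that preserves openers and closers and
  exchanges \<open>k\<close>-crossings with \<open>k\<close>-nestings. Such a matching is a partial permutation filling of a
  staircase, and Fomin's growth rules attach a partition to each of its corners. The partitions
  along the diagonal boundary determine the filling, and every chain of partitions that starts and
  ends with the empty one and changes by at most one box per step occurs. At a boundary corner the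
  first row is the length of a longest nesting, and the number of rows the length of a longest
  crossing, of the arcs passing over it. Hence transposing all boundary partitions is the
  involution.
\<close>

section \<open>Partitions and the local rule\<close>

text \<open>Transposition is not a symmetry of the local rule: a bumped box moves to the next row,
  never to the next column. Hence the interior of the diagram cannot simply be transposed; only the
  boundary is, and a second diagram is rebuilt from it backwards. For this the rule has to be
  deterministic in both directions and, backwards, has to accept every pair of steps. The boundary
  visits (i, i), (i, Suc i), (Suc i, Suc i): at vertex \<open>Suc i\<close> a closed arc first
  deletes a box, then an opened arc adds one. Whether such a step is trivial is unaffected by
  transposition, which is why openers and closers stay. Every crossing or nesting passes over the
  corner (i, i) at its last opener i, so only diagonal corners enter the comparison.\<close>

text \<open>Partitions are weakly decreasing functions that vanish eventually; row indices start at 0.\<close>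

definition inc :: "nat \<Rightarrow> (nat \<Rightarrow> nat) \<Rightarrow> nat \<Rightarrow> nat" where
  "inc k f = f(k := Suc (f k))"

definition young :: "(nat \<Rightarrow> nat) \<Rightarrow> bool" where
  "young f \<longleftrightarrow> (\<forall>k. f (Suc k) \<le> f k) \<and> (\<exists>K. f K = 0)"

definition step :: "(nat \<Rightarrow> nat) \<Rightarrow> (nat \<Rightarrow> nat) \<Rightarrow> bool" where
  "step f g \<longleftrightarrow> g = f \<or> (\<exists>k. g = inc k f)"

definition conjugate :: "(nat \<Rightarrow> nat) \<Rightarrow> nat \<Rightarrow> nat" where
  "conjugate f c = card {k. c < f k}"

lemma inc_apply: "inc k f i = (if i = k then Suc (f i) else f i)"
  by (simp add: inc_def)

lemma inc_neq [simp]: "inc k f \<noteq> f" "f \<noteq> inc k f"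
  by (metis inc_apply n_not_Suc_n)+

lemma step_refl [simp]: "step f f"
  and step_inc [simp]: "step f (inc k f)"
  by (auto simp: step_def)

lemma step_le: "step f g \<Longrightarrow> f k \<le> g k"
  by (auto simp: step_def inc_apply)

lemma young_antimono: "young f \<Longrightarrow> i \<le> j \<Longrightarrow> f j \<le> f i"
  by (simp add: young_def lift_Suc_antimono_le)

lemma young_zero [simp]: "young (\<lambda>_. 0)"
  by (simp add: young_def)

text \<open>Both inequalities say that the box in row k and column c lies in the diagram. The rows
  longer than c form an initial segment because \<open>f\<close> is weakly decreasing, so their
  number exceeds k iff row k is among them.\<close>

lemma less_conjugate_iff:
  assumes "young f"
  shows "k < conjugate f c \<longleftrightarrow> c < f k"
proof -
  obtain K where K: "f K = 0"
    using assms by (auto simp: young_def)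
  have sub: "{k. c < f k} \<subseteq> {..<K}"
    using young_antimono[OF assms, of K] K by (metis (mono_tags) lessThan_iff linorder_not_le
        mem_Collect_eq not_less_zero subsetI le_zero_eq)
  then have fin: "finite {k. c < f k}"
    using finite_subset by blast
  show ?thesis
  proof
    assume "c < f k"
    then have "{..k} \<subseteq> {k. c < f k}"
      using young_antimono[OF assms] by (auto intro: less_le_trans)
    then have "card {..k} \<le> conjugate f c"
      unfolding conjugate_def using fin by (rule card_mono[rotated])
    then show "k < conjugate f c" by simp
  next
    assume *: "k < conjugate f c"
    show "c < f k"
    proof (rule ccontr)
      assume "\<not> c < f k"
      then have "{k. c < f k} \<subseteq> {..<k}"
        using young_antimono[OF assms, of k] by (smt (verit) lessThan_iff linorder_not_le
            mem_Collect_eq order_trans subsetI)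
      then have "conjugate f c \<le> k"
        unfolding conjugate_def using card_mono[of "{..<k}"] by force
      with * show False by simp
    qed
  qed
qed

lemma eq_if_less_iff: "(\<And>k::nat. k < a \<longleftrightarrow> k < b) \<Longrightarrow> a = b"
  by (metis linorder_neqE_nat less_irrefl)

lemma young_conjugate:
  assumes "young f"
  shows "young (conjugate f)"
proof -
  have "conjugate f (Suc c) \<le> conjugate f c" for c
    using less_conjugate_iff[OF assms, of "conjugate f c"] by (meson Suc_lessD leI less_irrefl)
  moreover have "conjugate f (f 0) = 0"
    using less_conjugate_iff[OF assms, of 0] by auto
  ultimately show ?thesis
    unfolding young_def by blast
qed

lemma conjugate_conjugate: "young f \<Longrightarrow> conjugate (conjugate f) = f"
  by (rule ext, rule eq_if_less_iff) (simp add: less_conjugate_iff young_conjugate)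

lemma conjugate_zero [simp]: "conjugate (\<lambda>_. 0) = (\<lambda>_. 0)"
  by (simp add: conjugate_def fun_eq_iff)

text \<open>The new box lies in row k and column \<open>f k\<close>, hence in row \<open>f k\<close>
  after transposition. As \<open>inc k f\<close> is a partition, all rows above k are longer than
  \<open>f k\<close>; so column \<open>f k\<close> of \<open>f\<close> has length k and the box
  extends it.\<close>

lemma conjugate_inc:
  assumes f: "young f" and g: "young (inc k f)"
  shows "conjugate (inc k f) = inc (f k) (conjugate f)"
proof -
  have lt: "f k < f i" if "i < k" for i
    using young_antimono[OF g, of i k] that by (simp add: inc_apply)
  have ge: "f i \<le> f k" if "k \<le> i" for i
    using young_antimono[OF f] that by simp
  have "conjugate f (f k) = k"
    by (rule eq_if_less_iff) (metis lt ge less_conjugate_iff[OF f] linorder_not_less)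
  then have "i < inc (f k) (conjugate f) c \<longleftrightarrow> i < conjugate (inc k f) c" for i c
    using lt[of i] ge[of i] unfolding less_conjugate_iff[OF g] inc_apply
    by (cases i k rule: linorder_cases; cases "c = f k") (auto simp: less_conjugate_iff[OF f])
  then show ?thesis
    by (intro ext eq_if_less_iff) simp
qed

lemma step_conjugate: "young f \<Longrightarrow> young g \<Longrightarrow> step f g \<Longrightarrow> step (conjugate f) (conjugate g)"
  unfolding step_def using conjugate_inc by blast

lemma conjugate_eq_iff: "young f \<Longrightarrow> young g \<Longrightarrow> conjugate f = conjugate g \<longleftrightarrow> f = g"
  by (metis conjugate_conjugate)

text \<open>
  Fomin's local rule for a unit square with lower left corner \<open>r\<close>, neighbours \<open>u\<close> and \<open>v\<close> and opposite
  corner \<open>w\<close>; the Boolean says whether the square contains a point.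
\<close>

inductive cell ::
  "(nat \<Rightarrow> nat) \<Rightarrow> (nat \<Rightarrow> nat) \<Rightarrow> (nat \<Rightarrow> nat) \<Rightarrow> (nat \<Rightarrow> nat) \<Rightarrow> bool \<Rightarrow> bool"
where
  point: "cell r r r (inc 0 r) True"
| right: "step r v \<Longrightarrow> cell r r v v False"
| up: "step r u \<Longrightarrow> cell r u r u False"
| bump: "cell r (inc k r) (inc k r) (inc (Suc k) (inc k r)) False"
| join: "k \<noteq> l \<Longrightarrow> cell r (inc k r) (inc l r) (inc l (inc k r)) False"

lemma inc_commute: "inc k (inc l f) = inc l (inc k f)"
  by (auto simp: inc_def)

lemma cell_steps:
  assumes "cell r u v w m"
  shows "step r u" "step r v" "step u w" "step v w"
  using assms by (cases; simp; simp add: inc_commute)+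

text \<open>Triviality propagates through squares: parallel edges are trivial together, except at a
  point, where both incoming edges are trivial and both outgoing ones are not. Iterated along a row
  or column this detects the arcs.\<close>

lemma cell_eq_iff:
  assumes "cell r u v w m"
  shows "w = v \<longleftrightarrow> u = r \<and> \<not> m" "w = u \<longleftrightarrow> v = r \<and> \<not> m" "m \<Longrightarrow> u = r" "m \<Longrightarrow> v = r"
  using assms by (cases; auto; metis inc_commute inc_neq)+

text \<open>\<open>u\<close> and \<open>v\<close> agree in a row that \<open>w\<close> exceeds only
  at a point (row 0) or after a bump out of row k (row \<open>Suc k\<close>). So a bump shows one
  row below the row to be reduced; in all other cases \<open>r\<close> is the intersection of
  \<open>u\<close> and \<open>v\<close>.\<close>

lemma cell_backward:
  assumes "cell r u v w m"
  shows "r k = (if u (Suc k) = v (Suc k) \<and> u (Suc k) < w (Suc k) then u k - 1 else min (u k) (v k))"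
    and "m \<longleftrightarrow> u 0 = v 0 \<and> u 0 < w 0"
  using assms by (cases; auto simp: inc_apply dest: step_le[of _ _ k] step_le[of _ _ 0])+

lemma cell_forward:
  assumes "cell r u v w m"
  shows "w 0 = (if m then Suc (r 0) else max (u 0) (v 0))"
    and "w (Suc k) = (if u k = v k \<and> r k < u k then Suc (u (Suc k)) else max (u (Suc k)) (v (Suc k)))"
  using assms
  by (cases; auto simp: inc_apply dest: step_le[of _ _ k] step_le[of _ _ 0] step_le[of _ _ "Suc k"])+

lemma cell_unique_backward:
  assumes "cell r u v w m" "cell r' u v w m'"
  shows "r = r'" "m = m'"
  using cell_backward[OF assms(1)] cell_backward[OF assms(2)] by auto

lemma cell_unique_forward:
  assumes "cell r u v w m" "cell r u v w' m"
  shows "w = w'"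
proof
  fix k show "w k = w' k"
    using cell_forward[OF assms(1)] cell_forward[OF assms(2)] by (cases k) auto
qed

lemma cell_exists_forward:
  assumes y: "young r" "young u" "young v" and s: "step r u" "step r v"
    and m: "m \<Longrightarrow> u = r \<and> v = r"
  shows "\<exists>w. cell r u v w m \<and> young w"
proof (cases m)
  case True
  then have "cell r u v (inc 0 r) m" using m point by simp
  moreover have "young (inc 0 r)"
  proof -
    obtain K where "r K = 0" using y(1) by (auto simp: young_def)
    then have "inc 0 r (Suc K) = 0"
      using young_antimono[OF y(1), of K "Suc K"] by (simp add: inc_apply)
    then show ?thesis
      using y(1) unfolding young_def by (auto simp: inc_apply intro: le_SucI)
  qed
  ultimately show ?thesis by blast
next
  case False
  show ?thesis
  proof (cases "u = r \<or> v = r")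
    case True
    then show ?thesis using False s y right[of r v] up[of r u] by (elim disjE) auto
  next
    case 2: False
    then obtain k l where kl: "u = inc k r" "v = inc l r"
      using s by (auto simp: step_def)
    obtain K where K: "r K = 0" using y(1) by (auto simp: young_def)
    \<comment> \<open>This row lies beyond the empty row K and beyond the rows k, l and
      \<open>Suc k\<close>, so it stays empty in every result below.\<close>
    have z: "r (Suc (Suc (K + k + l))) = 0"
      using young_antimono[OF y(1), of K "Suc (Suc (K + k + l))"] K by simp
    show ?thesis
    proof (cases "k = l")
      case True
      have "inc (Suc k) u (Suc i) \<le> inc (Suc k) u i" for i
      proof -
        have "r (Suc i) \<le> r i" "u (Suc i) \<le> u i" using y by (auto simp: young_def)
        then show ?thesis unfolding kl by (auto simp: inc_apply split: if_splits)
      qed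
      moreover have "inc (Suc k) u (Suc (Suc (K + k + l))) = 0"
        using z kl True by (auto simp: inc_apply)
      ultimately have "young (inc (Suc k) u)" unfolding young_def by blast
      then show ?thesis using bump[of r k] kl True False by auto
    next
      case ne: False
      have "inc l u (Suc i) \<le> inc l u i" for i
      proof -
        have "r (Suc i) \<le> r i" "u (Suc i) \<le> u i" "v (Suc i) \<le> v i" using y by (auto simp: young_def)
        then show ?thesis using ne unfolding kl by (auto simp: inc_apply split: if_splits)
      qed
      moreover have "inc l u (Suc (Suc (K + k + l))) = 0"
        using z kl by (auto simp: inc_apply)
      ultimately have "young (inc l u)" unfolding young_def by blast
      then show ?thesis using join[OF ne] kl False by auto
    qed
  qed
qed

lemma inc_decr: "0 < f k \<Longrightarrow> inc k (f(k := f k - 1)) = f"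
  by (auto simp: inc_def)

text \<open>If \<open>w\<close> adds different boxes to \<open>u\<close> and \<open>v\<close>, then
  \<open>r\<close> is their common part. If it adds the same box, then \<open>u = v\<close>, and the
  box comes from a point when it lies in row 0 and from a bump out of the preceding row otherwise.
  The boundary thus dictates the points.\<close>

lemma cell_exists_backward:
  assumes y: "young u" "young v" "young w" and s: "step u w" "step v w"
  shows "\<exists>r m. cell r u v w m \<and> young r"
proof (cases "w = u \<or> w = v")
  case True
  then show ?thesis using s y right up by metis
next
  case False
  then obtain a b where ab: "w = inc a u" "w = inc b v"
    using s unfolding step_def by metis
  have yr: "young (u(k := u k - 1))" if "\<And>i. i = Suc k \<Longrightarrow> u i < u k \<or> u k = 0" for k
  proof -
    have "(u(k := u k - 1)) (Suc i) \<le> (u(k := u k - 1)) i" for i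
    proof -
      have "u (Suc i) \<le> u i" using y(1) by (auto simp: young_def)
      then show ?thesis using that[of "Suc i"] by auto
    qed
    moreover obtain K where "u K = 0" using y(1) by (auto simp: young_def)
    then have "(u(k := u k - 1)) K = 0" by auto
    ultimately show ?thesis unfolding young_def by blast
  qed
  show ?thesis
  proof (cases "a = b")
    case True
    have uv: "u = v"
    proof
      fix i show "u i = v i"
        using fun_cong[OF ab(1), of i] fun_cong[OF ab(2), of i] True by (auto simp: inc_apply split: if_splits)
    qed
    show ?thesis
    proof (cases a)
      case 0
      then show ?thesis using point uv ab y by auto
    next
      case (Suc k)
      have "w (Suc k) \<le> w k" using y(3) by (auto simp: young_def)
      then have lt: "u (Suc k) < u k" using ab(1) Suc by (auto simp: inc_apply)
      let ?r = "u(k := u k - 1)"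
      have "inc k ?r = u" using lt by (intro inc_decr) simp
      then have "cell ?r u v w False"
        using bump[of ?r k] uv ab(1) Suc by simp
      then show ?thesis using yr[of k] lt by blast
    qed
  next
    case ne: False
    have p: "u i = (if i = b then Suc (v i) else if i = a then v i - 1 else v i)"
       "v i = (if i = a then Suc (u i) else if i = b then u i - 1 else u i)" for i
      using fun_cong[OF ab(1), of i] fun_cong[OF ab(2), of i] ne by (auto simp: inc_apply split: if_splits)
    let ?r = "u(b := u b - 1)"
    have ub: "inc b ?r = u" using p(1)[of b] by (intro inc_decr) simp
    have va: "inc a ?r = v" using p(2) ne by (auto simp: inc_apply)
    have "cell ?r u v w False"
      using join[of b a ?r] ne ub va ab(1) by simp
    moreover have "young ?r"
    proof (rule yr)
      fix i assume i: "i = Suc b"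
      have "v (Suc b) \<le> v b" using y by (auto simp: young_def)
      moreover have "u b = Suc (v b)" using p(1)[of b] by simp
      moreover have "u (Suc b) \<le> v (Suc b)" using p(1)[of "Suc b"] by (simp split: if_splits)
      ultimately show "u i < u b \<or> u b = 0" using i by simp
    qed
    ultimately show ?thesis by blast
  qed
qed

section \<open>Growth diagrams\<close>

definition triangle :: "nat \<Rightarrow> (nat \<times> nat) set" where
  "triangle N = {(x, y). 0 < x \<and> x < y \<and> y \<le> N}"

text \<open>
  \<open>G i j\<close> is the partition of the arcs \<open>(x, y)\<close> with \<open>x \<le> i\<close> and \<open>j < y\<close>; closers are read in
  decreasing order, so the diagram starts on the lines \<open>i = 0\<close> and \<open>j = N\<close>.
\<close>

definition growth :: "nat \<Rightarrow> (nat \<times> nat) set \<Rightarrow> (nat \<Rightarrow> nat \<Rightarrow> nat \<Rightarrow> nat) \<Rightarrow> bool" where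
  "growth N A G \<longleftrightarrow> A \<subseteq> triangle N \<and>
     (\<forall>j\<le>N. G 0 j = (\<lambda>_. 0)) \<and> (\<forall>i\<le>N. G i N = (\<lambda>_. 0)) \<and>
     (\<forall>i j. i \<le> j \<longrightarrow> j \<le> N \<longrightarrow> young (G i j)) \<and>
     (\<forall>i j. i < j \<longrightarrow> j < N \<longrightarrow>
        cell (G i (Suc j)) (G (Suc i) (Suc j)) (G i j) (G (Suc i) j) ((Suc i, Suc j) \<in> A))"

text \<open>Each vertex opens at most one arc and closes at most one; it may do both.\<close>

definition matching :: "('v \<times> 'v) set \<Rightarrow> bool" where
  "matching A \<longleftrightarrow> single_valued A \<and> single_valued (A\<inverse>)"

text \<open>\<open>grow N A i d\<close> is the partition at \<open>(i, N - d)\<close>.\<close>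

fun grow :: "nat \<Rightarrow> (nat \<times> nat) set \<Rightarrow> nat \<Rightarrow> nat \<Rightarrow> nat \<Rightarrow> nat" where
  "grow N A 0 d = (\<lambda>_. 0)"
| "grow N A (Suc i) 0 = (\<lambda>_. 0)"
| "grow N A (Suc i) (Suc d) = (SOME w.
     cell (grow N A i d) (grow N A (Suc i) d) (grow N A i (Suc d)) w ((Suc i, N - d) \<in> A) \<and> young w)"

section \<open>Existence of the growth diagram of a matching\<close>

context
  fixes N :: nat and A :: "(nat \<times> nat) set"
  assumes A: "matching A"
begin

text \<open>\<open>vert\<close> and \<open>horiz\<close> say that an edge is trivial iff no arc has
  been met on its line so far. In a matching this makes both incoming edges of the square of a point
  trivial, as the local rule requires.\<close>

private definition vert :: "nat \<Rightarrow> nat \<Rightarrow> bool" where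
  "vert i d \<longleftrightarrow> step (grow N A i d) (grow N A i (Suc d)) \<and>
     (grow N A i (Suc d) = grow N A i d \<longleftrightarrow> (\<forall>x\<le>i. 0 < x \<longrightarrow> (x, N - d) \<notin> A))"

private definition horiz :: "nat \<Rightarrow> nat \<Rightarrow> bool" where
  "horiz i d \<longleftrightarrow> step (grow N A i d) (grow N A (Suc i) d) \<and>
     (grow N A (Suc i) d = grow N A i d \<longleftrightarrow> (\<forall>y\<le>N. N - d < y \<longrightarrow> (Suc i, y) \<notin> A))"

private lemma grow_cell:
  assumes y: "young (grow N A i d)" "young (grow N A (Suc i) d)" "young (grow N A i (Suc d))"
    and h: "horiz i d" and v: "vert i d" and d: "d < N"
  shows "cell (grow N A i d) (grow N A (Suc i) d) (grow N A i (Suc d)) (grow N A (Suc i) (Suc d))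
           ((Suc i, N - d) \<in> A) \<and> young (grow N A (Suc i) (Suc d)) \<and> vert (Suc i) d \<and> horiz i (Suc d)"
proof -
  let ?m = "(Suc i, N - d) \<in> A"
  have m: "grow N A (Suc i) d = grow N A i d \<and> grow N A i (Suc d) = grow N A i d" if ?m
  proof -
    have "(Suc i, y) \<notin> A" if "N - d < y" for y
      using A \<open>?m\<close> that unfolding matching_def single_valued_def by blast
    moreover have "(x, N - d) \<notin> A" if "x \<le> i" for x
      using A \<open>?m\<close> that unfolding matching_def single_valued_def
      by (metis converse_iff not_less_eq_eq order_refl)
    ultimately show ?thesis
      using h v unfolding horiz_def vert_def by blast
  qed
  have "\<exists>w. cell (grow N A i d) (grow N A (Suc i) d) (grow N A i (Suc d)) w ?m \<and> young w"
    using cell_exists_forward[OF y _ _ m] h v unfolding horiz_def vert_def by blast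
  then have c: "cell (grow N A i d) (grow N A (Suc i) d) (grow N A i (Suc d))
      (grow N A (Suc i) (Suc d)) ?m" and yw: "young (grow N A (Suc i) (Suc d))"
    unfolding grow.simps by (rule someI2_ex; blast)+
  have "vert (Suc i) d"
    using cell_steps[OF c] cell_eq_iff(2)[OF c] v unfolding vert_def by (metis le_Suc_eq zero_less_Suc)
  moreover have "horiz i (Suc d)"
  proof -
    have "(N - Suc d < y) \<longleftrightarrow> (y = N - d \<or> N - d < y)" for y
      using d by auto
    then show ?thesis
      using cell_steps[OF c] cell_eq_iff(1)[OF c] h unfolding horiz_def by (metis diff_le_self)
  qed
  ultimately show ?thesis
    using c yw by blast
qed

private lemma grow_invariant:
  "d \<le> N \<Longrightarrow> young (grow N A i d) \<and> (d < N \<longrightarrow> vert i d)"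
  "d \<le> N \<Longrightarrow> horiz i d"
proof -
  have *: "(\<forall>d\<le>N. young (grow N A i d) \<and> (d < N \<longrightarrow> vert i d)) \<and>
           (\<forall>d\<le>N. young (grow N A (Suc i) d) \<and> (d < N \<longrightarrow> vert (Suc i) d) \<and> horiz i d)" for i
  proof (induction i)
    have row: "\<forall>d\<le>N. young (grow N A (Suc i) d) \<and> (d < N \<longrightarrow> vert (Suc i) d) \<and> horiz i d"
      if IH: "\<forall>d\<le>N. young (grow N A i d) \<and> (d < N \<longrightarrow> vert i d)" for i
    proof -
      have "d \<le> N \<longrightarrow> young (grow N A (Suc i) d) \<and> horiz i d" for d
      proof (induction d)
        case 0
        then show ?case by (cases i) (auto simp: horiz_def)
      next
        case (Suc d)
        then show ?case using grow_cell[of i d] IH by auto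
      qed
      then show ?thesis
        using grow_cell[of i] IH by (meson Suc_leI order_less_imp_le)
    qed
    {
      case 0
      have "\<forall>d\<le>N. young (grow N A 0 d) \<and> (d < N \<longrightarrow> vert 0 d)"
        by (auto simp: vert_def)
      then show ?case using row[of 0] by blast
    next
      case (Suc i)
      then show ?case using row[of "Suc i"] by blast
    }
  qed
  show "d \<le> N \<Longrightarrow> young (grow N A i d) \<and> (d < N \<longrightarrow> vert i d)"
    "d \<le> N \<Longrightarrow> horiz i d"
    using *[of i] by blast+
qed

lemma growth_exists:
  assumes "A \<subseteq> triangle N"
  shows "\<exists>G. growth N A G"
proof -
  define G where "G i j = grow N A i (N - j)" for i j
  have "cell (G i (Suc j)) (G (Suc i) (Suc j)) (G i j) (G (Suc i) j) ((Suc i, Suc j) \<in> A)"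
    if "j < N" for i j
  proof -
    obtain d where d: "N - j = Suc d" "N - Suc j = d" "N - d = Suc j" "d < N"
      by (rule that[of "N - Suc j"]) (use \<open>j < N\<close> in auto)
    show ?thesis
      using grow_cell[of i d] grow_invariant d unfolding G_def d by (metis Suc_leI order_less_imp_le)
  qed
  moreover have "G 0 j = (\<lambda>_. 0)" "G i N = (\<lambda>_. 0)" "young (G i j)" for i j
    using grow_invariant(1)[of "N - j" i] by (simp_all add: G_def) (cases i; simp)
  ultimately have "growth N A G"
    using assms unfolding growth_def by blast
  then show ?thesis by blast
qed

end

section \<open>Reading the arcs off a growth diagram\<close>

context
  fixes N A G
  assumes growth: "growth N A G"
begin

lemma growth_cell:
  "i < j \<Longrightarrow> j < N \<Longrightarrow>
     cell (G i (Suc j)) (G (Suc i) (Suc j)) (G i j) (G (Suc i) j) ((Suc i, Suc j) \<in> A)"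
  and growth_young: "i \<le> j \<Longrightarrow> j \<le> N \<Longrightarrow> young (G i j)"
  and growth_left: "j \<le> N \<Longrightarrow> G 0 j = (\<lambda>_. 0)"
  and growth_bottom: "i \<le> N \<Longrightarrow> G i N = (\<lambda>_. 0)"
  and growth_triangle: "A \<subseteq> triangle N"
  using growth unfolding growth_def by blast+

text \<open>Going up from the line j = N, the horizontal edge becomes nontrivial at the first point
  of the column and remains so. A point needs a trivial incoming edge, so a second one cannot
  follow.\<close>

lemma growth_column:
  assumes "i < j" "j \<le> N"
  shows "step (G i j) (G (Suc i) j) \<and> (G (Suc i) j = G i j \<longleftrightarrow> (\<forall>y. j < y \<longrightarrow> (Suc i, y) \<notin> A)) \<and>
    (\<forall>y y'. j < y \<longrightarrow> j < y' \<longrightarrow> (Suc i, y) \<in> A \<longrightarrow> (Suc i, y') \<in> A \<longrightarrow> y = y')"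
  using assms(2,1)
proof (induction rule: inc_induct)
  case base
  then show ?case
    using growth_bottom growth_triangle by (auto simp: triangle_def)
next
  case (step j)
  have c: "cell (G i (Suc j)) (G (Suc i) (Suc j)) (G i j) (G (Suc i) j) ((Suc i, Suc j) \<in> A)"
    using step growth_cell by simp
  have split: "j < y \<longleftrightarrow> y = Suc j \<or> Suc j < y" for y
    by auto
  show ?case
  proof (intro conjI)
    show "step (G i j) (G (Suc i) j)"
      using cell_steps(4)[OF c] .
    show "G (Suc i) j = G i j \<longleftrightarrow> (\<forall>y. j < y \<longrightarrow> (Suc i, y) \<notin> A)"
      unfolding cell_eq_iff(1)[OF c] split using step by auto
    show "\<forall>y y'. j < y \<longrightarrow> j < y' \<longrightarrow> (Suc i, y) \<in> A \<longrightarrow> (Suc i, y') \<in> A \<longrightarrow> y = y'"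
      unfolding split using step cell_eq_iff(3)[OF c] by auto
  qed
qed

lemma growth_row:
  assumes "i \<le> j" "j < N"
  shows "step (G i (Suc j)) (G i j) \<and> (G i j = G i (Suc j) \<longleftrightarrow> (\<forall>x\<le>i. (x, Suc j) \<notin> A)) \<and>
    (\<forall>x x'. x \<le> i \<longrightarrow> x' \<le> i \<longrightarrow> (x, Suc j) \<in> A \<longrightarrow> (x', Suc j) \<in> A \<longrightarrow> x = x')"
  using assms(1)
proof (induction i)
  case 0
  then show ?case
    using growth_left assms growth_triangle by (auto simp: triangle_def)
next
  case (Suc i)
  have c: "cell (G i (Suc j)) (G (Suc i) (Suc j)) (G i j) (G (Suc i) j) ((Suc i, Suc j) \<in> A)"
    using Suc assms growth_cell by simp
  have split: "x \<le> Suc i \<longleftrightarrow> x = Suc i \<or> x \<le> i" for x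
    by auto
  show ?case
  proof (intro conjI)
    show "step (G (Suc i) (Suc j)) (G (Suc i) j)"
      using cell_steps(3)[OF c] .
    show "G (Suc i) j = G (Suc i) (Suc j) \<longleftrightarrow> (\<forall>x\<le>Suc i. (x, Suc j) \<notin> A)"
      unfolding cell_eq_iff(2)[OF c] split using Suc by auto
    show "\<forall>x x'. x \<le> Suc i \<longrightarrow> x' \<le> Suc i \<longrightarrow> (x, Suc j) \<in> A \<longrightarrow> (x', Suc j) \<in> A \<longrightarrow> x = x'"
      unfolding split using Suc cell_eq_iff(4)[OF c] by auto
  qed
qed

text \<open>\<open>growth\<close> does not presuppose a matching; this is what is needed for the
  arcs rebuilt from the transposed boundary.\<close>

lemma growth_matching: "matching A"
proof -
  have "y = y'" if A: "(x, y) \<in> A" "(x, y') \<in> A" for x y y'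
  proof -
    obtain i where "x = Suc i" "Suc i < y" "Suc i < y'" "Suc i \<le> N"
      using A growth_triangle unfolding triangle_def by (cases x) fastforce+
    then show ?thesis
      using growth_column[of i "Suc i"] A by blast
  qed
  moreover have "x = x'" if A: "(x, y) \<in> A" "(x', y) \<in> A" for x x' y
  proof -
    obtain j where "y = Suc j" "x \<le> j" "x' \<le> j" "j < N"
      using A growth_triangle unfolding triangle_def by (cases y) fastforce+
    then show ?thesis
      using growth_row[of j j] A by blast
  qed
  ultimately show ?thesis
    unfolding matching_def single_valued_def by blast
qed

text \<open>All arcs opened at \<open>Suc i\<close> close later, so the edge at the diagonal has met
  every one of them. The criterion compares boundary partitions only and thus survives
  transposition.\<close>

lemma growth_opener_iff:
  assumes "i < N"
  shows "Suc i \<in> Domain A \<longleftrightarrow> G (Suc i) (Suc i) \<noteq> G i (Suc i)"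
  using growth_column[of i "Suc i"] assms growth_triangle by (auto simp: triangle_def)

lemma growth_closer_iff:
  assumes "i < N"
  shows "Suc i \<in> Range A \<longleftrightarrow> G i i \<noteq> G i (Suc i)"
  using growth_row[of i i] assms growth_triangle by (fastforce simp: triangle_def)

end

text \<open>Induction on the distance d from the diagonal. The square whose corner \<open>r\<close>
  has distance d + 2 has its other corners at distances d + 1 and d, so two neighbouring diagonals
  are carried along.\<close>

lemma growth_unique_backward:
  assumes g: "growth N A G" "growth N A' G'"
    and b: "\<And>i. i \<le> N \<Longrightarrow> G i i = G' i i" "\<And>i. i < N \<Longrightarrow> G i (Suc i) = G' i (Suc i)"
  shows "A = A'"
proof -
  have *: "(\<forall>i. i + d \<le> N \<longrightarrow> G i (i + d) = G' i (i + d)) \<and>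
        (\<forall>i. i + Suc d \<le> N \<longrightarrow> G i (i + Suc d) = G' i (i + Suc d))" for d
  proof (induction d)
    case 0
    then show ?case using b by auto
  next
    case (Suc d)
    have "G i (i + Suc (Suc d)) = G' i (i + Suc (Suc d))" if "i + Suc (Suc d) \<le> N" for i
    proof -
      have "i < i + Suc d" "i + Suc d < N" using that by auto
      from growth_cell[OF g(1) this] growth_cell[OF g(2) this]
      have "cell (G i (i + Suc (Suc d))) (G (Suc i) (Suc i + Suc d)) (G i (i + Suc d)) (G (Suc i) (Suc i + d))
          ((Suc i, Suc i + Suc d) \<in> A)"
        and "cell (G' i (i + Suc (Suc d))) (G' (Suc i) (Suc i + Suc d)) (G' i (i + Suc d)) (G' (Suc i) (Suc i + d))
          ((Suc i, Suc i + Suc d) \<in> A')"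
        by simp_all
      moreover have "Suc i + Suc d \<le> N" "i + Suc d \<le> N" "Suc i + d \<le> N"
        using that by auto
      ultimately show ?thesis
        using Suc.IH cell_unique_backward(1) by metis
    qed
    then show ?case using Suc by blast
  qed
  have eq: "G i j = G' i j" if "i \<le> j" "j \<le> N" for i j
    using *[of "j - i"] that by (metis le_add_diff_inverse)
  have mem: "(Suc i, Suc j) \<in> A \<longleftrightarrow> (Suc i, Suc j) \<in> A'" if "i < j" "j < N" for i j
  proof -
    have "G i (Suc j) = G' i (Suc j)" "G (Suc i) (Suc j) = G' (Suc i) (Suc j)" "G i j = G' i j"
      "G (Suc i) j = G' (Suc i) j"
      using eq that by auto
    then show ?thesis
      using growth_cell[OF g(1) that] growth_cell[OF g(2) that] cell_unique_backward(2) by metis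
  qed
  have "p \<in> A \<longleftrightarrow> p \<in> A'" if "p \<in> triangle N" for p
  proof -
    from that obtain i j where "p = (Suc i, Suc j)" "i < j" "j < N"
      unfolding triangle_def by (cases p; cases "fst p"; cases "snd p") auto
    then show ?thesis using mem by blast
  qed
  then show ?thesis
    using g(1,2)[THEN growth_triangle] by blast
qed

lemma growth_unique_forward:
  assumes g: "growth N A G" "growth N A G'" and ij: "i \<le> j" "j \<le> N"
  shows "G i j = G' i j"
  using ij
proof (induction i arbitrary: j)
  case 0
  then show ?case using g[THEN growth_left] by simp
next
  case (Suc i)
  from Suc.prems(2,1) show ?case
  proof (induction rule: inc_induct)
    case base
    then show ?case using g[THEN growth_bottom] by simp
  next
    case (step j)
    have "G i (Suc j) = G' i (Suc j)" "G i j = G' i j"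
      using Suc.IH step by auto
    moreover have "i < j" "j < N" "G (Suc i) (Suc j) = G' (Suc i) (Suc j)" using step by auto
    ultimately show ?case
      using growth_cell[OF g(1), of i j] growth_cell[OF g(2), of i j] cell_unique_forward by metis
  qed
qed

text \<open>\<open>shrink a b i d\<close> is the partition at \<open>(i, i + d)\<close> of the diagram with boundary \<open>a\<close>, \<open>b\<close>.\<close>

fun shrink :: "(nat \<Rightarrow> nat \<Rightarrow> nat) \<Rightarrow> (nat \<Rightarrow> nat \<Rightarrow> nat) \<Rightarrow> nat \<Rightarrow> nat \<Rightarrow> nat \<Rightarrow> nat" where
  "shrink a b i 0 = a i"
| "shrink a b i (Suc 0) = b i"
| "shrink a b i (Suc (Suc d)) = (SOME r. (\<exists>m.
     cell r (shrink a b (Suc i) (Suc d)) (shrink a b i (Suc d)) (shrink a b (Suc i) d) m) \<and> young r)"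

text \<open>The triangle is filled from the diagonal outwards by the backward rule, and each square
  decides by itself whether it contains a point.\<close>

lemma growth_from_boundary:
  assumes a: "\<And>i. i \<le> N \<Longrightarrow> young (a i)" and b: "\<And>i. i < N \<Longrightarrow> young (b i)"
    and s: "\<And>i. i < N \<Longrightarrow> step (b i) (a i)" "\<And>i. i < N \<Longrightarrow> step (b i) (a (Suc i))"
    and z: "a 0 = (\<lambda>_. 0)" "a N = (\<lambda>_. 0)"
  shows "\<exists>A G. growth N A G \<and> (\<forall>i\<le>N. G i i = a i) \<and> (\<forall>i<N. G i (Suc i) = b i)"
proof -
  let ?S = "shrink a b"
  define P where "P i d \<longleftrightarrow> young (?S i (Suc d)) \<and> step (?S i (Suc d)) (?S i d) \<and>
      step (?S i (Suc d)) (?S (Suc i) d)" for i d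
  have cell_step: "(\<exists>m. cell (?S i (Suc (Suc d))) (?S (Suc i) (Suc d)) (?S i (Suc d)) (?S (Suc i) d) m) \<and>
      P i (Suc d)"
    if "P i d" "P (Suc i) d" "young (?S (Suc i) d)" for i d
  proof -
    have "\<exists>r. (\<exists>m. cell r (?S (Suc i) (Suc d)) (?S i (Suc d)) (?S (Suc i) d) m) \<and> young r"
      using cell_exists_backward that unfolding P_def by blast
    from someI_ex[OF this]
    have "(\<exists>m. cell (?S i (Suc (Suc d))) (?S (Suc i) (Suc d)) (?S i (Suc d)) (?S (Suc i) d) m) \<and>
        young (?S i (Suc (Suc d)))"
      by simp
    then show ?thesis unfolding P_def using cell_steps by blast
  qed
  have inv: "(\<forall>i. i + d \<le> N \<longrightarrow> young (?S i d)) \<and> (\<forall>i. i + d < N \<longrightarrow> P i d)" for d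
  proof (induction d)
    case 0
    then show ?case using a b s by (auto simp: P_def)
  next
    case (Suc d)
    then have "P i (Suc d)" if "i + Suc d < N" for i
      using cell_step[of i d] that by simp
    then show ?case using Suc P_def by auto
  qed
  define G where "G i j = ?S i (j - i)" for i j
  \<comment> \<open>The Boolean of a square is determined by \<open>u\<close>, \<open>v\<close>,
    \<open>w\<close>, so testing the rule with \<open>True\<close> recovers it.\<close>
  define A where "A = {(Suc i, Suc j) |i j. i < j \<and> j < N \<and>
      cell (G i (Suc j)) (G (Suc i) (Suc j)) (G i j) (G (Suc i) j) True}"
  have ex_cell: "\<exists>m. cell (G i (Suc j)) (G (Suc i) (Suc j)) (G i j) (G (Suc i) j) m" if ij: "i < j" "j < N" for i j
  proof -
    obtain d where d: "j = Suc (i + d)" using ij(1) less_imp_Suc_add by blast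
    then have e: "Suc j - i = Suc (Suc d)" "Suc j - Suc i = Suc d" "j - i = Suc d" "j - Suc i = d"
      by auto
    have "P i d" "P (Suc i) d" "young (?S (Suc i) d)"
      using inv[of d] that d by auto
    then show ?thesis
      unfolding G_def e using cell_step by blast
  qed
  have cells: "cell (G i (Suc j)) (G (Suc i) (Suc j)) (G i j) (G (Suc i) j) ((Suc i, Suc j) \<in> A)"
    if ij: "i < j" "j < N" for i j
  proof -
    obtain m where m: "cell (G i (Suc j)) (G (Suc i) (Suc j)) (G i j) (G (Suc i) j) m"
      using ex_cell[OF ij] by blast
    moreover have "(Suc i, Suc j) \<in> A \<longleftrightarrow>
        cell (G i (Suc j)) (G (Suc i) (Suc j)) (G i j) (G (Suc i) j) True"
      using ij by (simp add: A_def)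
    then have "(Suc i, Suc j) \<in> A \<longleftrightarrow> m"
      using m cell_unique_backward(2)[OF m] by metis
    ultimately show ?thesis by simp
  qed
  have yG: "young (G i j)" if "i \<le> j" "j \<le> N" for i j
    using inv[of "j - i"] that by (simp add: G_def)
  have PG: "P i (j - i)" if "i \<le> j" "j < N" for i j
    using inv[of "j - i"] that by auto
  \<comment> \<open>Partitions can only shrink on the way from the diagonal to \<open>r\<close>, so
    the empty corners \<open>a 0\<close> and \<open>a N\<close> force both initial lines to be
    empty.\<close>
  have left: "G 0 j = (\<lambda>_. 0)" if "j \<le> N" for j
    using that
  proof (induction j)
    case 0
    then show ?case using z by (simp add: G_def)
  next
    case (Suc j)
    have "step (G 0 (Suc j)) (G 0 j)"
      using PG[of 0 j] Suc.prems by (simp add: P_def G_def)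
    then show ?case using Suc step_le[of "G 0 (Suc j)" "G 0 j"] by auto
  qed
  have bottom: "G i N = (\<lambda>_. 0)" if "i \<le> N" for i
    using that
  proof (induction rule: inc_induct)
    case base
    then show ?case using z by (simp add: G_def)
  next
    case (step i)
    have "Suc (N - Suc i) = N - i" using step by auto
    then have "step (G i N) (G (Suc i) N)"
      using PG[of i "N - 1"] step by (simp add: P_def G_def)
    then show ?case using step step_le[of "G i N" "G (Suc i) N"] by auto
  qed
  have "A \<subseteq> triangle N"
    by (auto simp: A_def triangle_def)
  then have "growth N A G"
    using cells yG left bottom unfolding growth_def by blast
  moreover have "\<forall>i\<le>N. G i i = a i" "\<forall>i<N. G i (Suc i) = b i"
    by (auto simp: G_def)
  ultimately show ?thesis by blast
qed

section \<open>Shadow lines\<close>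

text \<open>
  Viennot's shadow lines of the points \<open>M\<close>: \<open>r i j\<close> counts the lines that meet the region
  \<open>x \<le> i \<and> j < y\<close>. An increment of \<open>r\<close> is emitted to the right and upwards by each point, travels
  straight on, and two increments annihilate where they meet, at the points of the skeleton \<open>S\<close>.
\<close>

definition shadow ::
  "nat \<Rightarrow> (nat \<Rightarrow> nat \<Rightarrow> nat) \<Rightarrow> (nat \<times> nat) set \<Rightarrow> (nat \<times> nat) set \<Rightarrow> bool" where
  "shadow N r M S \<longleftrightarrow> M \<subseteq> triangle N \<and> S \<subseteq> triangle N \<and>
     (\<forall>j\<le>N. r 0 j = 0) \<and> (\<forall>i\<le>N. r i N = 0) \<and>
     (\<forall>i j. i < j \<longrightarrow> j < N \<longrightarrow>
       (if (Suc i, Suc j) \<in> M then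
          (Suc i, Suc j) \<notin> S \<and> r (Suc i) (Suc j) = r i (Suc j) \<and> r i j = r i (Suc j) \<and>
          r (Suc i) j = Suc (r i (Suc j))
        else if (Suc i, Suc j) \<in> S then
          r (Suc i) (Suc j) = Suc (r i (Suc j)) \<and> r i j = Suc (r i (Suc j)) \<and>
          r (Suc i) j = Suc (r i (Suc j))
        else
          r (Suc i) (Suc j) = r i (Suc j) \<and> r (Suc i) j = r i j \<and>
            (r i j = r i (Suc j) \<or> r i j = Suc (r i (Suc j))) \<or>
          r i j = r i (Suc j) \<and> r (Suc i) j = r (Suc i) (Suc j) \<and>
            (r (Suc i) (Suc j) = r i (Suc j) \<or> r (Suc i) (Suc j) = Suc (r i (Suc j)))))"

text \<open>All arcs pass over the corner (i, j): bounding the last opener and the first closer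
  bounds the others by monotonicity.\<close>

definition crossing_in :: "(nat \<times> nat) set \<Rightarrow> nat \<Rightarrow> nat \<Rightarrow> nat \<Rightarrow> bool" where
  "crossing_in M n i j \<longleftrightarrow> (\<exists>x y. (\<forall>m<n. (x m, y m) \<in> M) \<and>
     (\<forall>m. Suc m < n \<longrightarrow> x m < x (Suc m) \<and> y m < y (Suc m)) \<and>
     (0 < n \<longrightarrow> x (n - 1) \<le> i \<and> j < y 0))"

definition nesting_in :: "(nat \<times> nat) set \<Rightarrow> nat \<Rightarrow> nat \<Rightarrow> nat \<Rightarrow> bool" where
  "nesting_in M n i j \<longleftrightarrow> (\<exists>x y. (\<forall>m<n. (x m, y m) \<in> M) \<and>
     (\<forall>m. Suc m < n \<longrightarrow> x m < x (Suc m) \<and> y (Suc m) < y m) \<and>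
     (0 < n \<longrightarrow> x (n - 1) \<le> i \<and> j < y (n - 1)))"

section \<open>Propagation of shadow lines\<close>

context
  fixes N r M S
  assumes sh: "shadow N r M S"
begin

text \<open>\<open>V i j\<close>: a horizontal ray crosses the grid edge between (i, Suc j) and (i,
  j). \<open>H i j\<close>: a vertical ray crosses the edge between (i, j) and (Suc i, j).\<close>

private abbreviation V where "V i j \<equiv> r i j = Suc (r i (Suc j))"
private abbreviation H where "H i j \<equiv> r (Suc i) j = Suc (r i j)"

private lemma local_rule:
  assumes "i < j" "j < N"
  shows "(if (Suc i, Suc j) \<in> M then
          (Suc i, Suc j) \<notin> S \<and> r (Suc i) (Suc j) = r i (Suc j) \<and> r i j = r i (Suc j) \<and>
          r (Suc i) j = Suc (r i (Suc j))
        else if (Suc i, Suc j) \<in> S then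
          r (Suc i) (Suc j) = Suc (r i (Suc j)) \<and> r i j = Suc (r i (Suc j)) \<and>
          r (Suc i) j = Suc (r i (Suc j))
        else
          r (Suc i) (Suc j) = r i (Suc j) \<and> r (Suc i) j = r i j \<and>
            (r i j = r i (Suc j) \<or> r i j = Suc (r i (Suc j))) \<or>
          r i j = r i (Suc j) \<and> r (Suc i) j = r (Suc i) (Suc j) \<and>
            (r (Suc i) (Suc j) = r i (Suc j) \<or> r (Suc i) (Suc j) = Suc (r i (Suc j))))"
  using sh assms unfolding shadow_def by blast

text \<open>In order: a point emits both rays (1, 2); a skeleton point absorbs both (3, 4); rays
  meet only at skeleton points and start together only at points (5, 6); a ray continues forwards
  unless absorbed (7, 8) and backwards unless emitted (9, 10); \<open>r\<close> is monotone (11,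
  12).\<close>

private lemma rules:
  assumes "i < j" "j < N"
  shows "(Suc i, Suc j) \<in> M \<Longrightarrow> V (Suc i) j" "(Suc i, Suc j) \<in> M \<Longrightarrow> H i j"
    "(Suc i, Suc j) \<in> S \<Longrightarrow> V i j" "(Suc i, Suc j) \<in> S \<Longrightarrow> H i (Suc j)"
    "V i j \<Longrightarrow> H i (Suc j) \<Longrightarrow> (Suc i, Suc j) \<in> S"
    "V (Suc i) j \<Longrightarrow> H i j \<Longrightarrow> (Suc i, Suc j) \<in> M"
    "V i j \<Longrightarrow> (Suc i, Suc j) \<notin> S \<Longrightarrow> V (Suc i) j"
    "H i (Suc j) \<Longrightarrow> (Suc i, Suc j) \<notin> S \<Longrightarrow> H i j"
    "V (Suc i) j \<Longrightarrow> (Suc i, Suc j) \<notin> M \<Longrightarrow> V i j"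
    "H i j \<Longrightarrow> (Suc i, Suc j) \<notin> M \<Longrightarrow> H i (Suc j)"
    "r i j \<le> r (Suc i) j" "r (Suc i) (Suc j) \<le> r (Suc i) j"
  using local_rule[OF assms] by (auto split: if_splits)

private lemma zero: "j \<le> N \<Longrightarrow> r 0 j = 0" "i \<le> N \<Longrightarrow> r i N = 0"
  using sh by (auto simp: shadow_def)

private lemma in_triangle:
  assumes "p \<in> M \<or> p \<in> S"
  obtains i j where "p = (Suc i, Suc j)" "i < j" "j < N"
proof -
  have "p \<in> triangle N"
    using assms sh by (auto simp: shadow_def)
  then show ?thesis
    using that unfolding triangle_def by (cases p; cases "fst p"; cases "snd p") auto
qed

private lemma mono:
  assumes "i \<le> i'" "i' \<le> j'" "j' \<le> j" "j \<le> N"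
  shows "r i j \<le> r i' j'"
proof -
  have "r i j \<le> r i' j"
    using assms(1) assms(2,3)
  proof (induction rule: dec_induct)
    case (step m)
    then have "r m j \<le> r (Suc m) j"
      using rules(11)[of m j] zero(2)[of m] zero(2)[of "Suc m"] assms by (cases "j = N") auto
    then show ?case using step by auto
  qed simp
  also have "r i' j \<le> r i' j'"
    using assms(3,4)
  proof (induction rule: dec_induct)
    case (step m)
    then have "r i' (Suc m) \<le> r i' m"
      using rules(12)[of "i' - 1" m] zero(1)[of m] zero(1)[of "Suc m"] assms by (cases i') auto
    then show ?case using step by auto
  qed simp
  finally show ?thesis .
qed

text \<open>
  The increments emitted by the two points run towards the cell \<open>(x', y)\<close>, so a skeleton point stops
  one of them earlier or lies there. The half-open boxes of consecutive points of a crossing are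
  disjoint and ordered, so the skeleton points found form a crossing again; dually for
  \<open>point_between\<close>.
\<close>

private lemma skeleton_between:
  assumes "(x, y) \<in> M" "(x', y') \<in> M" "x < x'" "y < y'" "x' < y"
  shows "\<exists>p q. (p, q) \<in> S \<and> x < p \<and> p \<le> x' \<and> y \<le> q \<and> q < y'"
proof (rule ccontr)
  assume "\<not> ?thesis"
  then have none: "(p, q) \<notin> S" if "x < p" "p \<le> x'" "y \<le> q" "q < y'" for p q
    using that by blast
  obtain i j where ij: "x = Suc i" "y = Suc j" "i < j" "j < N"
    using in_triangle assms(1) by blast
  obtain i' j' where ij': "x' = Suc i'" "y' = Suc j'" "i' < j'" "j' < N"
    using in_triangle assms(2) by blast
  have "x \<le> i'" using assms ij' by simp
  then have "V i' j"
  proof (induction rule: dec_induct)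
    case base
    then show ?case using rules(1)[of i j] ij assms by simp
  next
    case (step p)
    then show ?case using rules(7)[of p j] none[of "Suc p" y] ij ij' assms by simp
  qed
  moreover have "Suc j \<le> j'" using assms ij ij' by simp
  then have "H i' (Suc j)"
  proof (induction rule: inc_induct)
    case base
    then show ?case using rules(2)[of i' j'] ij' assms by simp
  next
    case (step q)
    then show ?case using rules(8)[of i' q] none[of x' "Suc q"] ij ij' assms by simp
  qed
  \<comment> \<open>Here \<open>x' < y\<close> is essential: it places the meeting square (x', y)
    inside the triangle.\<close>
  ultimately have "(Suc i', Suc j) \<in> S"
    using rules(5)[of i' j] ij ij' assms by simp
  then show False
    using none ij ij' assms by auto
qed

private lemma point_between:
  assumes "(x, y) \<in> S" "(x', y') \<in> S" "x < x'" "y < y'" "x' < y"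
  shows "\<exists>p q. (p, q) \<in> M \<and> x \<le> p \<and> p < x' \<and> y < q \<and> q \<le> y'"
proof (rule ccontr)
  assume "\<not> ?thesis"
  then have none: "(p, q) \<notin> M" if "x \<le> p" "p < x'" "y < q" "q \<le> y'" for p q
    using that by blast
  obtain i j where ij: "x = Suc i" "y = Suc j" "i < j" "j < N"
    using in_triangle assms(1) by blast
  obtain i' j' where ij': "x' = Suc i'" "y' = Suc j'" "i' < j'" "j' < N"
    using in_triangle assms(2) by blast
  have "y \<le> j'" using assms ij' by simp
  then have "H i j'"
  proof (induction rule: dec_induct)
    case base
    then show ?case using rules(4)[of i j] ij assms by simp
  next
    case (step q)
    then show ?case using rules(10)[of i q] none[of x "Suc q"] ij ij' assms by simp
  qed
  moreover have "x \<le> i'" using assms ij ij' by simp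
  then have "V x j'"
  proof (induction rule: inc_induct)
    case base
    then show ?case using rules(3)[of i' j'] ij' assms by simp
  next
    case (step p)
    then show ?case using rules(9)[of p j'] none[of "Suc p" y'] ij ij' assms by simp
  qed
  ultimately have "(Suc i, Suc j') \<in> M"
    using rules(6)[of i j'] ij ij' assms by simp
  then show False
    using none ij ij' assms by auto
qed

text \<open>Followed backwards, the horizontal ray absorbed here must have been emitted by a point
  of the same row; otherwise it would reach the line i = 0, where \<open>r\<close> vanishes.
  \<open>point_below\<close> follows the vertical ray to j = N instead.\<close>

private lemma point_left:
  assumes "(x, y) \<in> S"
  shows "\<exists>p. (p, y) \<in> M \<and> p < x"
proof (rule ccontr)
  assume "\<not> ?thesis"
  then have none: "(p, y) \<notin> M" if "p < x" for p
    using that by blast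
  obtain i j where ij: "x = Suc i" "y = Suc j" "i < j" "j < N"
    using in_triangle assms(1) by blast
  have "0 \<le> i" by simp
  then have "V 0 j"
  proof (induction rule: inc_induct)
    case base
    then show ?case using rules(3)[of i j] ij assms by simp
  next
    case (step p)
    then show ?case using rules(9)[of p j] none[of "Suc p"] ij by simp
  qed
  then show False using zero(1)[of j] ij by simp
qed

private lemma point_below:
  assumes "(x, y) \<in> S"
  shows "\<exists>q. (x, q) \<in> M \<and> y < q"
proof (rule ccontr)
  assume "\<not> ?thesis"
  then have none: "(x, q) \<notin> M" if "y < q" for q
    using that by blast
  obtain i j where ij: "x = Suc i" "y = Suc j" "i < j" "j < N"
    using in_triangle assms(1) by blast
  have "y \<le> N" using ij by simp
  then have "H i N"
  proof (induction rule: dec_induct)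
    case base
    then show ?case using rules(4)[of i j] ij assms by simp
  next
    case (step q)
    then show ?case using rules(10)[of i q] none[of "Suc q"] ij by simp
  qed
  then show False using zero(2)[of "Suc i"] ij by simp
qed

text \<open>\<open>r\<close> obeys the recursion of the longest nesting: at a square without a point
  it is the maximum of the two neighbouring values, and at a point it grows by one, that point being
  the innermost arc.\<close>

lemma shadow_nesting_iff:
  assumes "i \<le> j" "j \<le> N"
  shows "nesting_in M n i j \<longleftrightarrow> n \<le> r i j"
proof
  show "nesting_in M n i j \<Longrightarrow> n \<le> r i j"
    using assms
  proof (induction n arbitrary: i j)
    case (Suc n)
    then obtain x y where xy: "\<forall>m<Suc n. (x m, y m) \<in> M"
      "\<forall>m. Suc m < Suc n \<longrightarrow> x m < x (Suc m) \<and> y (Suc m) < y m" "x n \<le> i" "j < y n"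
      unfolding nesting_in_def by auto
    obtain a b where ab: "x n = Suc a" "y n = Suc b" "a < b" "b < N"
      using in_triangle[of "(x n, y n)"] xy by (metis Pair_inject lessI)
    have "nesting_in M n a (Suc b)"
      unfolding nesting_in_def
    proof (intro exI conjI)
      show "0 < n \<longrightarrow> x (n - 1) \<le> a \<and> Suc b < y (n - 1)"
        using xy(2)[rule_format, of "n - 1"] ab by auto
    qed (use xy in auto)
    then have "n \<le> r a (Suc b)"
      using Suc.IH ab by simp
    moreover have "(Suc a, Suc b) \<in> M"
      using xy(1) ab by (metis lessI)
    ultimately have "Suc n \<le> r (Suc a) b"
      using local_rule[OF ab(3,4)] by simp
    also have "\<dots> \<le> r i j"
      using mono[of "Suc a" i j b] xy ab Suc.prems by auto
    finally show ?case .
  qed simp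
next
  have weaken: "nesting_in M n i j" if "nesting_in M n i' j'" "i' \<le> i" "j \<le> j'" for n i j i' j'
  proof -
    obtain x y where "\<forall>m<n. (x m, y m) \<in> M"
      "\<forall>m. Suc m < n \<longrightarrow> x m < x (Suc m) \<and> y (Suc m) < y m"
      "0 < n \<longrightarrow> x (n - 1) \<le> i' \<and> j' < y (n - 1)"
      using \<open>nesting_in M n i' j'\<close> unfolding nesting_in_def by blast
    then show ?thesis
      unfolding nesting_in_def using that(2,3) by (intro exI[of _ x] exI[of _ y]) auto
  qed
  show "n \<le> r i j \<Longrightarrow> nesting_in M n i j"
    using assms
  proof (induction "i + (N - j)" arbitrary: n i j rule: less_induct)
    case less
    show ?case
    proof (cases n)
      case 0
      then show ?thesis by (simp add: nesting_in_def)
    next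
      case (Suc n')
      then have "i \<noteq> 0" "j \<noteq> N" using less.prems zero(1)[of j] zero(2)[of i] by (auto intro: Nat.gr0I)
      then obtain a where a: "i = Suc a" "a < j" "j < N"
        using less.prems by (cases i) auto
      show ?thesis
      proof (cases "(i, Suc j) \<in> M")
        case True
        then have "n' \<le> r a (Suc j)"
          using local_rule[OF a(2,3)] less.prems Suc a by simp
        then have "nesting_in M n' a (Suc j)"
          using less.hyps[of a "Suc j" n'] a by simp
        then obtain x y where xy: "\<forall>m<n'. (x m, y m) \<in> M"
            "\<forall>m. Suc m < n' \<longrightarrow> x m < x (Suc m) \<and> y (Suc m) < y m"
            "0 < n' \<longrightarrow> x (n' - 1) \<le> a \<and> Suc j < y (n' - 1)"
          unfolding nesting_in_def by blast
        show ?thesis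
          unfolding nesting_in_def
        proof (intro exI conjI)
          let ?x = "x(n' := i)" and ?y = "y(n' := Suc j)"
          show "\<forall>m<n. (?x m, ?y m) \<in> M"
            using xy True Suc by auto
          show "\<forall>m. Suc m < n \<longrightarrow> ?x m < ?x (Suc m) \<and> ?y (Suc m) < ?y m"
          proof (intro allI impI)
            fix m assume m: "Suc m < n"
            show "?x m < ?x (Suc m) \<and> ?y (Suc m) < ?y m"
            proof (cases "Suc m = n'")
              case True
              then have "0 < n'" "m = n' - 1" by auto
              then show ?thesis using xy(3) a True by auto
            next
              case False
              then show ?thesis using xy(2) m Suc by auto
            qed
          qed
          show "0 < n \<longrightarrow> ?x (n - 1) \<le> i \<and> j < ?y (n - 1)"
            using Suc by simp
        qed
      next
        case False
        then have "r i j = r i (Suc j) \<or> r i j = r a j"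
          using local_rule[OF a(2,3)] a by (auto split: if_splits)
        then show ?thesis
        proof
          assume "r i j = r i (Suc j)"
          then have "nesting_in M n i (Suc j)"
            using less.hyps[of i "Suc j" n] less.prems a by simp
          then show ?thesis by (rule weaken) auto
        next
          assume "r i j = r a j"
          then have "nesting_in M n a j"
            using less.hyps[of a j n] less.prems a by simp
          then show ?thesis by (rule weaken) (use a in auto)
        qed
      qed
    qed
  qed
qed

lemma shadow_crossing_one_iff:
  assumes "i \<le> j" "j \<le> N"
  shows "crossing_in M (Suc 0) i j \<longleftrightarrow> 0 < r i j"
  using shadow_nesting_iff[OF assms, of "Suc 0"]
  by (simp add: crossing_in_def nesting_in_def Suc_le_eq)

text \<open>The n + 2 points have n + 1 gaps, each with a skeleton point. Conversely, n + 1 skeleton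
  points have n gaps, each with a point, and \<open>point_left\<close> and
  \<open>point_below\<close> supply one more at either end.\<close>

lemma shadow_crossing_iff:
  assumes "i \<le> j" "j \<le> N"
  shows "crossing_in M (Suc (Suc n)) i j \<longleftrightarrow> crossing_in S (Suc n) i j"
proof
  assume "crossing_in M (Suc (Suc n)) i j"
  then obtain x y where xy: "\<And>m. m < Suc (Suc n) \<Longrightarrow> (x m, y m) \<in> M"
      "\<And>m. m < Suc n \<Longrightarrow> x m < x (Suc m) \<and> y m < y (Suc m)" "x (Suc n) \<le> i" "j < y 0"
    unfolding crossing_in_def by auto
  have xle: "x m \<le> i" if "m \<le> Suc n" for m
    using that
  proof (induction rule: inc_induct)
    case base
    then show ?case using xy by simp
  next
    case (step m)
    then show ?case using xy(2)[of m] by simp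
  qed
  have yge: "m \<le> Suc n \<longrightarrow> j < y m" for m
  proof (induction m)
    case (Suc m)
    then show ?case using xy(2)[of m] by auto
  qed (use xy in simp)
  have "\<forall>m<Suc n. \<exists>p. p \<in> S \<and> x m < fst p \<and> fst p \<le> x (Suc m) \<and> y m \<le> snd p \<and> snd p < y (Suc m)"
  proof (intro allI impI)
    fix m assume m: "m < Suc n"
    have "x (Suc m) < y m"
      using xle[of "Suc m"] yge[of m] assms m by simp
    then show "\<exists>p. p \<in> S \<and> x m < fst p \<and> fst p \<le> x (Suc m) \<and> y m \<le> snd p \<and> snd p < y (Suc m)"
      using skeleton_between[of "x m" "y m" "x (Suc m)" "y (Suc m)"] xy m by force
  qed
  then obtain p where p: "\<And>m. m < Suc n \<Longrightarrow> p m \<in> S \<and> x m < fst (p m) \<and> fst (p m) \<le> x (Suc m) \<and>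
      y m \<le> snd (p m) \<and> snd (p m) < y (Suc m)"
    by metis
  show "crossing_in S (Suc n) i j"
    unfolding crossing_in_def
  proof (intro exI conjI allI impI)
    fix m
    show "m < Suc n \<Longrightarrow> (fst (p m), snd (p m)) \<in> S"
      using p by simp
    assume "Suc m < Suc n"
    then show "fst (p m) < fst (p (Suc m))" "snd (p m) < snd (p (Suc m))"
      using p[of m] p[of "Suc m"] by linarith+
  next
    show "fst (p (Suc n - 1)) \<le> i" "j < snd (p 0)"
      using p[of n] p[of 0] xy by auto
  qed
next
  assume "crossing_in S (Suc n) i j"
  then obtain x y where xy: "\<And>m. m < Suc n \<Longrightarrow> (x m, y m) \<in> S"
      "\<And>m. m < n \<Longrightarrow> x m < x (Suc m) \<and> y m < y (Suc m)" "x n \<le> i" "j < y 0"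
    unfolding crossing_in_def by auto
  have xle: "x m \<le> i" if "m \<le> n" for m
    using that
  proof (induction rule: inc_induct)
    case base
    then show ?case using xy by simp
  next
    case (step m)
    then show ?case using xy(2)[of m] by simp
  qed
  have yge: "m \<le> n \<longrightarrow> j < y m" for m
  proof (induction m)
    case (Suc m)
    then show ?case using xy(2)[of m] by auto
  qed (use xy in simp)
  obtain a where a: "(a, y 0) \<in> M" "a < x 0"
    using point_left[of "x 0" "y 0"] xy by auto
  obtain b where b: "(x n, b) \<in> M" "y n < b"
    using point_below[of "x n" "y n"] xy by auto
  have "\<forall>m<n. \<exists>p. p \<in> M \<and> x m \<le> fst p \<and> fst p < x (Suc m) \<and> y m < snd p \<and> snd p \<le> y (Suc m)"
  proof (intro allI impI)
    fix m assume m: "m < n"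
    have "x (Suc m) < y m"
      using xle[of "Suc m"] yge[of m] assms m by simp
    then show "\<exists>p. p \<in> M \<and> x m \<le> fst p \<and> fst p < x (Suc m) \<and> y m < snd p \<and> snd p \<le> y (Suc m)"
      using point_between[of "x m" "y m" "x (Suc m)" "y (Suc m)"] xy m by force
  qed
  then obtain p where p: "\<And>m. m < n \<Longrightarrow> p m \<in> M \<and> x m \<le> fst (p m) \<and> fst (p m) < x (Suc m) \<and>
      y m < snd (p m) \<and> snd (p m) \<le> y (Suc m)"
    by metis
  \<comment> \<open>\<open>p m\<close> lies between the skeleton points m and m + 1, so it becomes
    entry m + 1; \<open>(a, y 0)\<close> precedes and \<open>(x n, b)\<close> follows all of
    them.\<close>
  define q where "q m = (if m = 0 then (a, y 0) else if m = Suc n then (x n, b) else p (m - 1))" for m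
  have q: "q m \<in> M \<and> (0 < m \<longrightarrow> x (m - 1) \<le> fst (q m) \<and> y (m - 1) < snd (q m)) \<and>
      (m < Suc n \<longrightarrow> fst (q m) < x m \<and> snd (q m) \<le> y m)" if "m \<le> Suc n" for m
    using that a b p[of "m - 1"] by (cases m) (auto simp: q_def)
  show "crossing_in M (Suc (Suc n)) i j"
    unfolding crossing_in_def
  proof (intro exI conjI allI impI)
    fix m
    show "m < Suc (Suc n) \<Longrightarrow> (fst (q m), snd (q m)) \<in> M"
      using q[of m] by simp
    assume "Suc m < Suc (Suc n)"
    then show "fst (q m) < fst (q (Suc m))" "snd (q m) < snd (q (Suc m))"
      using q[of m] q[of "Suc m"] by auto
  next
    show "fst (q (Suc (Suc n) - 1)) \<le> i" "j < snd (q 0)"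
      using xy by (auto simp: q_def)
  qed
qed

end

text \<open>Row \<open>Suc k\<close> of the growth diagram is the diagram of the skeleton of row \<open>k\<close>.\<close>

definition layer :: "nat \<Rightarrow> (nat \<times> nat) set \<Rightarrow> (nat \<Rightarrow> nat \<Rightarrow> nat \<Rightarrow> nat) \<Rightarrow> nat \<Rightarrow> (nat \<times> nat) set" where
  "layer N A G k = (case k of 0 \<Rightarrow> A | Suc l \<Rightarrow> {(Suc i, Suc j) |i j. i < j \<and> j < N \<and>
     G (Suc i) (Suc j) l = Suc (G i (Suc j) l) \<and> G i j l = Suc (G i (Suc j) l)})"

text \<open>In the local rule row k + 1 receives a fresh box exactly when both neighbours extend row
  k of \<open>r\<close>, that is, at a skeleton point of row k. All other increments of a row pass
  straight through the square.\<close>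

lemma shadow_layer:
  assumes "growth N A G"
  shows "shadow N (\<lambda>i j. G i j k) (layer N A G k) (layer N A G (Suc k))"
proof -
  have S: "(Suc i, Suc j) \<in> layer N A G (Suc l) \<longleftrightarrow> i < j \<and> j < N \<and>
     G (Suc i) (Suc j) l = Suc (G i (Suc j) l) \<and> G i j l = Suc (G i (Suc j) l)" for i j l
    by (auto simp: layer_def)
  have M0: "layer N A G 0 = A"
    by (simp add: layer_def)
  have sub: "layer N A G l \<subseteq> triangle N" for l
    using growth_triangle[OF assms] by (auto simp: layer_def triangle_def split: nat.splits)
  show ?thesis
    unfolding shadow_def
  proof (intro conjI sub allI impI)
    fix i j assume ij: "i < j" "j < N"
    have c: "cell (G i (Suc j)) (G (Suc i) (Suc j)) (G i j) (G (Suc i) j) ((Suc i, Suc j) \<in> A)"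
      using growth_cell[OF assms ij] .
    have M: "(Suc i, Suc j) \<in> layer N A G k \<longleftrightarrow> (case k of 0 \<Rightarrow> (Suc i, Suc j) \<in> A | Suc l \<Rightarrow>
       G (Suc i) (Suc j) l = Suc (G i (Suc j) l) \<and> G i j l = Suc (G i (Suc j) l))"
      using ij by (cases k) (simp_all add: S M0)
    show "(if (Suc i, Suc j) \<in> layer N A G k then
          (Suc i, Suc j) \<notin> layer N A G (Suc k) \<and> G (Suc i) (Suc j) k = G i (Suc j) k \<and> G i j k = G i (Suc j) k \<and>
          G (Suc i) j k = Suc (G i (Suc j) k)
        else if (Suc i, Suc j) \<in> layer N A G (Suc k) then
          G (Suc i) (Suc j) k = Suc (G i (Suc j) k) \<and> G i j k = Suc (G i (Suc j) k) \<and>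
          G (Suc i) j k = Suc (G i (Suc j) k)
        else
          G (Suc i) (Suc j) k = G i (Suc j) k \<and> G (Suc i) j k = G i j k \<and>
            (G i j k = G i (Suc j) k \<or> G i j k = Suc (G i (Suc j) k)) \<or>
          G i j k = G i (Suc j) k \<and> G (Suc i) j k = G (Suc i) (Suc j) k \<and>
            (G (Suc i) (Suc j) k = G i (Suc j) k \<or> G (Suc i) (Suc j) k = Suc (G i (Suc j) k)))"
      unfolding M S using c ij
      by cases (auto simp: step_def inc_apply split: nat.splits if_splits)
  qed (use growth_left[OF assms] growth_bottom[OF assms] in auto)
qed

section \<open>Longest nestings and crossings at a corner\<close>

lemma growth_nesting_iff:
  assumes "growth N A G" "i \<le> j" "j \<le> N"
  shows "nesting_in A n i j \<longleftrightarrow> n \<le> G i j 0"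
  using shadow_nesting_iff[OF shadow_layer[OF assms(1), of 0] assms(2,3)] by (simp add: layer_def)

text \<open>Each passage to the next row replaces the points by their skeleton and shortens the
  crossing by one. After n passages a single point is left, which shows as a nonempty row n.\<close>

lemma growth_crossing_iff:
  assumes "growth N A G" "i \<le> j" "j \<le> N"
  shows "crossing_in A (Suc n) i j \<longleftrightarrow> 0 < G i j n"
proof -
  have "crossing_in (layer N A G k) (Suc n) i j \<longleftrightarrow> 0 < G i j (k + n)" for k
  proof (induction n arbitrary: k)
    case 0
    then show ?case using shadow_crossing_one_iff[OF shadow_layer[OF assms(1)] assms(2,3)] by simp
  next
    case (Suc n)
    then show ?case using shadow_crossing_iff[OF shadow_layer[OF assms(1)] assms(2,3)] by simp
  qed
  from this[of 0] show ?thesis by (simp add: layer_def)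
qed

section \<open>Exchanging crossings and nestings\<close>

text \<open>The diagonal corner at the last opener lies under every arc of the crossing; conversely,
  arcs over a common diagonal corner have all openers before all closers.\<close>

lemma has_k_crossing_iff_crossing_in:
  assumes "A \<subseteq> triangle N"
  shows "has_k_crossing A (Suc n) \<longleftrightarrow> (\<exists>i\<le>N. crossing_in A (Suc n) i i)"
proof
  assume "has_k_crossing A (Suc n)"
  then obtain x y where xy: "\<forall>m<Suc n. (x m, y m) \<in> A"
    "\<forall>m. Suc m < Suc n \<longrightarrow> x m < x (Suc m) \<and> y m < y (Suc m)" "x n < y 0"
    unfolding has_k_crossing_def by auto
  moreover have "x n \<le> N"
    using xy(1) assms unfolding triangle_def by fastforce
  ultimately show "\<exists>i\<le>N. crossing_in A (Suc n) i i"
    unfolding crossing_in_def by (intro exI[of _ "x n"] conjI exI[of _ x] exI[of _ y]) auto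
next
  assume "\<exists>i\<le>N. crossing_in A (Suc n) i i"
  then obtain i x y where xy: "\<forall>m<Suc n. (x m, y m) \<in> A"
    "\<forall>m. Suc m < Suc n \<longrightarrow> x m < x (Suc m) \<and> y m < y (Suc m)" "x n \<le> i" "i < y 0"
    unfolding crossing_in_def by auto
  then show "has_k_crossing A (Suc n)"
    unfolding has_k_crossing_def by (intro exI[of _ x] exI[of _ y]) auto
qed

lemma has_k_nesting_iff_nesting_in:
  assumes "A \<subseteq> triangle N"
  shows "has_k_nesting A (Suc n) \<longleftrightarrow> (\<exists>i\<le>N. nesting_in A (Suc n) i i)"
proof
  assume "has_k_nesting A (Suc n)"
  then obtain x y where xy: "\<forall>m<Suc n. (x m, y m) \<in> A"
    "\<forall>m. Suc m < Suc n \<longrightarrow> x m < x (Suc m) \<and> y (Suc m) < y m" "x n < y n"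
    unfolding has_k_nesting_def by auto
  moreover have "x n \<le> N"
    using xy(1) assms unfolding triangle_def by fastforce
  ultimately show "\<exists>i\<le>N. nesting_in A (Suc n) i i"
    unfolding nesting_in_def by (intro exI[of _ "x n"] conjI exI[of _ x] exI[of _ y]) auto
next
  assume "\<exists>i\<le>N. nesting_in A (Suc n) i i"
  then obtain i x y where xy: "\<forall>m<Suc n. (x m, y m) \<in> A"
    "\<forall>m. Suc m < Suc n \<longrightarrow> x m < x (Suc m) \<and> y (Suc m) < y m" "x n \<le> i" "i < y n"
    unfolding nesting_in_def by auto
  then show "has_k_nesting A (Suc n)"
    unfolding has_k_nesting_def by (intro exI[of _ x] exI[of _ y]) auto
qed

text \<open>The partitions at \<open>(i, i)\<close> and \<open>(i, Suc i)\<close> determine the whole diagram, hence the arcs.\<close>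

definition dual :: "nat \<Rightarrow> (nat \<times> nat) set \<Rightarrow> (nat \<times> nat) set \<Rightarrow> bool" where
  "dual N A B \<longleftrightarrow> (\<exists>G H. growth N A G \<and> growth N B H \<and>
     (\<forall>i\<le>N. H i i = conjugate (G i i)) \<and> (\<forall>i<N. H i (Suc i) = conjugate (G i (Suc i))))"

lemma dual_exists:
  assumes "matching A" "A \<subseteq> triangle N"
  shows "\<exists>B. dual N A B"
proof -
  obtain G where G: "growth N A G"
    using growth_exists assms by blast
  have "\<exists>B H. growth N B H \<and> (\<forall>i\<le>N. H i i = conjugate (G i i)) \<and>
      (\<forall>i<N. H i (Suc i) = conjugate (G i (Suc i)))"
  proof (rule growth_from_boundary)
    fix i assume i: "i < N"
    show "young (conjugate (G i (Suc i)))"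
      using growth_young[OF G, of i "Suc i"] i by (simp add: young_conjugate)
    show "step (conjugate (G i (Suc i))) (conjugate (G i i))"
      using growth_young[OF G] growth_row[OF G, of i i] i by (intro step_conjugate) auto
    show "step (conjugate (G i (Suc i))) (conjugate (G (Suc i) (Suc i)))"
      using growth_young[OF G] growth_column[OF G, of i "Suc i"] i by (intro step_conjugate) auto
  qed (use growth_young[OF G] growth_left[OF G, of 0] growth_bottom[OF G, of N] in
      \<open>auto simp: young_conjugate\<close>)
  then show ?thesis
    unfolding dual_def using G by blast
qed

lemma dual_sym:
  assumes "dual N A B"
  shows "dual N B A"
proof -
  obtain G H where G: "growth N A G" and H: "growth N B H"
    and eq: "\<forall>i\<le>N. H i i = conjugate (G i i)" "\<forall>i<N. H i (Suc i) = conjugate (G i (Suc i))"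
    using assms unfolding dual_def by blast
  have "\<forall>i\<le>N. G i i = conjugate (H i i)" "\<forall>i<N. G i (Suc i) = conjugate (H i (Suc i))"
    using eq growth_young[OF G] by (simp_all add: conjugate_conjugate)
  then show ?thesis
    unfolding dual_def using G H by blast
qed

text \<open>Forward uniqueness identifies the two diagrams of \<open>A\<close>, hence the transposed
  boundaries; backward uniqueness then identifies the arcs.\<close>

lemma dual_unique:
  assumes "dual N A B" "dual N A B'"
  shows "B = B'"
proof -
  obtain G H where G: "growth N A G" and H: "growth N B H"
    and eq: "\<forall>i\<le>N. H i i = conjugate (G i i)" "\<forall>i<N. H i (Suc i) = conjugate (G i (Suc i))"
    using assms(1) unfolding dual_def by blast
  obtain G' H' where G': "growth N A G'" and H': "growth N B' H'"
    and eq': "\<forall>i\<le>N. H' i i = conjugate (G' i i)" "\<forall>i<N. H' i (Suc i) = conjugate (G' i (Suc i))"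
    using assms(2) unfolding dual_def by blast
  show ?thesis
    by (rule growth_unique_backward[OF H H']) (use eq eq' growth_unique_forward[OF G G'] in auto)
qed

lemma dual_matching:
  assumes "dual N A B"
  shows "matching B \<and> B \<subseteq> triangle N"
proof -
  obtain H where "growth N B H"
    using assms unfolding dual_def by blast
  then show ?thesis
    using growth_matching[of N B H] growth_triangle[of N B H] by simp
qed

lemma dual_Domain_Range:
  assumes "dual N A B"
  shows "Domain B = Domain A" "Range B = Range A"
proof -
  obtain G H where G: "growth N A G" and H: "growth N B H"
    and eq: "\<forall>i\<le>N. H i i = conjugate (G i i)" "\<forall>i<N. H i (Suc i) = conjugate (G i (Suc i))"
    using assms unfolding dual_def by blast
  have sub: "C \<subseteq> triangle N \<Longrightarrow> Domain C \<subseteq> Suc ` {..<N} \<and> Range C \<subseteq> Suc ` {..<N}" for C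
    unfolding triangle_def lessThan_atLeast0 image_Suc_atLeastLessThan by fastforce
  have "(Suc i \<in> Domain B \<longleftrightarrow> Suc i \<in> Domain A) \<and> (Suc i \<in> Range B \<longleftrightarrow> Suc i \<in> Range A)" if "i < N" for i
    using that eq growth_young[OF G]
    by (simp add: growth_opener_iff[OF G] growth_opener_iff[OF H] growth_closer_iff[OF G]
        growth_closer_iff[OF H] conjugate_eq_iff)
  then show "Domain B = Domain A" "Range B = Range A"
    using sub[OF growth_triangle[OF G]] sub[OF growth_triangle[OF H]] by blast+
qed

text \<open>The first row of the transposed partition at (i, i) is as long as the original partition
  has rows.\<close>

lemma dual_nesting_iff_crossing:
  assumes "dual N A B"
  shows "has_k_nesting B k \<longleftrightarrow> has_k_crossing A k"
proof (cases k)
  case 0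
  then show ?thesis by (simp add: has_k_nesting_def has_k_crossing_def)
next
  case (Suc n)
  obtain G H where G: "growth N A G" and H: "growth N B H" and eq: "\<forall>i\<le>N. H i i = conjugate (G i i)"
    using assms unfolding dual_def by blast
  show ?thesis
    unfolding Suc has_k_crossing_iff_crossing_in[OF growth_triangle[OF G]]
      has_k_nesting_iff_nesting_in[OF growth_triangle[OF H]]
    using eq by (auto simp: growth_nesting_iff[OF H] growth_crossing_iff[OF G] Suc_le_eq
        less_conjugate_iff growth_young[OF G])
qed

section \<open>Transport along order isomorphisms\<close>

lemma has_k_crossing_image:
  fixes p :: "'a::linorder \<Rightarrow> 'b::linorder"
  assumes p: "strict_mono_on V p" and A: "A \<subseteq> V \<times> V" and c: "has_k_crossing A k"
  shows "has_k_crossing (map_prod p p ` A) k"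
proof -
  obtain x y where xy: "\<forall>m<k. (x m, y m) \<in> A"
    "\<forall>m. Suc m < k \<longrightarrow> x m < x (Suc m) \<and> y m < y (Suc m)" "0 < k \<longrightarrow> x (k - 1) < y 0"
    using c unfolding has_k_crossing_def by blast
  have V: "x m \<in> V \<and> y m \<in> V" if "m < k" for m
    using xy(1) A that by blast
  show ?thesis
    unfolding has_k_crossing_def
    using xy V by (intro exI[of _ "p \<circ> x"] exI[of _ "p \<circ> y"])
      (auto intro!: strict_mono_onD[OF p] rev_image_eqI)
qed

lemma has_k_nesting_image:
  fixes p :: "'a::linorder \<Rightarrow> 'b::linorder"
  assumes p: "strict_mono_on V p" and A: "A \<subseteq> V \<times> V" and c: "has_k_nesting A k"
  shows "has_k_nesting (map_prod p p ` A) k"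
proof -
  obtain x y where xy: "\<forall>m<k. (x m, y m) \<in> A"
    "\<forall>m. Suc m < k \<longrightarrow> x m < x (Suc m) \<and> y (Suc m) < y m" "0 < k \<longrightarrow> x (k - 1) < y (k - 1)"
    using c unfolding has_k_nesting_def by blast
  have V: "x m \<in> V \<and> y m \<in> V" if "m < k" for m
    using xy(1) A that by blast
  show ?thesis
    unfolding has_k_nesting_def
    using xy V by (intro exI[of _ "p \<circ> x"] exI[of _ "p \<circ> y"])
      (auto intro!: strict_mono_onD[OF p] rev_image_eqI)
qed

definition arc_set :: "'v::linorder set \<Rightarrow> ('v \<times> 'v) set \<Rightarrow> bool" where
  "arc_set V A \<longleftrightarrow> matching A \<and> (\<forall>(u, v) \<in> A. u \<in> V \<and> v \<in> V \<and> u < v)"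

lemma matching_image:
  assumes "inj_on p V" "A \<subseteq> V \<times> V" "matching A"
  shows "matching (map_prod p p ` A)"
proof -
  have A: "x \<in> V" "y \<in> V" if "(x, y) \<in> A" for x y
    using assms(2) that by auto
  have "single_valued (map_prod p p ` A)"
  proof (rule single_valuedI)
    fix a b c assume "(a, b) \<in> map_prod p p ` A" "(a, c) \<in> map_prod p p ` A"
    then obtain x y x' y' where e: "(x, y) \<in> A" "(x', y') \<in> A" "p x = a" "p x' = a" "p y = b" "p y' = c"
      by (auto simp: map_prod_def)
    then have "x = x'" using inj_onD[OF assms(1), of x x'] A by simp
    then show "b = c" using e assms(3) by (auto simp: matching_def dest: single_valuedD)
  qed
  moreover have "single_valued ((map_prod p p ` A)\<inverse>)"
  proof (rule single_valuedI)
    fix a b c assume "(a, b) \<in> (map_prod p p ` A)\<inverse>" "(a, c) \<in> (map_prod p p ` A)\<inverse>"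
    then obtain x y x' y' where e: "(x, y) \<in> A" "(x', y') \<in> A" "p y = a" "p y' = a" "p x = b" "p x' = c"
      by (auto simp: map_prod_def)
    then have "y = y'" using inj_onD[OF assms(1), of y y'] A by simp
    then show "b = c" using e assms(3) by (auto simp: matching_def dest: single_valuedD)
  qed
  ultimately show ?thesis
    by (simp add: matching_def)
qed

lemma arc_set_image:
  fixes p :: "'a::linorder \<Rightarrow> 'b::linorder"
  assumes "strict_mono_on V p" "arc_set V A"
  shows "arc_set (p ` V) (map_prod p p ` A)"
  unfolding arc_set_def
proof
  show "matching (map_prod p p ` A)"
    using assms strict_mono_on_imp_inj_on by (intro matching_image[of p V]) (auto simp: arc_set_def)
  show "\<forall>(u, v)\<in>map_prod p p ` A. u \<in> p ` V \<and> v \<in> p ` V \<and> u < v"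
    using assms(2) by (fastforce simp: arc_set_def intro: strict_mono_onD[OF assms(1)])
qed

lemma arc_set_subset: "arc_set V A \<Longrightarrow> A \<subseteq> V \<times> V"
  by (auto simp: arc_set_def)

text \<open>Crossings and nestings depend only on the relative order of the vertices. Ranking is an
  order isomorphism \<open>p\<close> from V onto {1..N} with inverse \<open>q\<close>, along which
  \<open>dual\<close> is pulled back.\<close>

lemma crossing_nesting_involution:
  fixes V :: "'v::linorder set"
  assumes "finite V"
  shows "\<exists>T. \<forall>A. arc_set V A \<longrightarrow> arc_set V (T A) \<and> T (T A) = A \<and>
    Domain (T A) = Domain A \<and> Range (T A) = Range A \<and>
    (\<forall>k. has_k_crossing (T A) k \<longleftrightarrow> has_k_nesting A k) \<and>
    (\<forall>k. has_k_nesting (T A) k \<longleftrightarrow> has_k_crossing A k)"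
proof -
  define N where "N = card V"
  \<comment> \<open>The rank counts \<open>v\<close> itself, so ranks start at 1: coordinate 0 is
    reserved for the empty initial line of the diagram.\<close>
  define p where "p v = card {u \<in> V. u \<le> v}" for v
  define q where "q = inv_into V p"
  have p: "strict_mono_on V p"
  proof (rule strict_mono_onI)
    fix u v assume "u \<in> V" "v \<in> V" "u < v"
    then have "v \<in> {w \<in> V. w \<le> v} - {w \<in> V. w \<le> u}" "{w \<in> V. w \<le> u} \<subseteq> {w \<in> V. w \<le> v}"
      by auto
    then have "{w \<in> V. w \<le> u} \<subset> {w \<in> V. w \<le> v}" by blast
    then show "p u < p v"
      unfolding p_def using assms by (intro psubset_card_mono) auto
  qed
  then have inj: "inj_on p V" by (rule strict_mono_on_imp_inj_on)
  have range: "p ` V = {1..N}"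
  proof (rule card_subset_eq)
    have "p v \<in> {1..N}" if "v \<in> V" for v
    proof -
      have "{v} \<subseteq> {u \<in> V. u \<le> v}" using that by auto
      then have "card {v} \<le> p v"
        unfolding p_def using assms by (intro card_mono) auto
      moreover have "p v \<le> N"
        unfolding p_def N_def using assms by (intro card_mono) auto
      ultimately show ?thesis by simp
    qed
    then show "p ` V \<subseteq> {1..N}" by blast
    show "card (p ` V) = card {1..N}"
      using card_image[OF inj] by (simp add: N_def)
  qed simp
  have qp: "q (p v) = v" if "v \<in> V" for v
    using inj that by (simp add: q_def)
  have pq: "p (q i) = i \<and> q i \<in> V" if "i \<in> {1..N}" for i
    using that unfolding range[symmetric] q_def by (simp add: f_inv_into_f inv_into_into)
  have q: "strict_mono_on {1..N} q"
    by (rule strict_mono_onI) (metis linorder_less_linear order_less_asym p pq strict_mono_onD)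
  have q_range: "q ` {1..N} = V"
    unfolding range[symmetric] image_image using qp by simp
  define P where "P A = map_prod p p ` A" for A
  define Q where "Q B = map_prod q q ` B" for B
  have PQ: "P (Q B) = B" if "arc_set {1..N} B" for B
  proof -
    have "map_prod p p (map_prod q q e) = e" if "e \<in> B" for e
      using \<open>arc_set {1..N} B\<close> that pq unfolding arc_set_def by (cases e) auto
    then show ?thesis unfolding P_def Q_def image_image by simp
  qed
  have QP: "Q (P A) = A" if "arc_set V A" for A
  proof -
    have "map_prod q q (map_prod p p e) = e" if "e \<in> A" for e
      using \<open>arc_set V A\<close> that qp unfolding arc_set_def by (cases e) auto
    then show ?thesis unfolding P_def Q_def image_image by simp
  qed
  have P: "arc_set {1..N} (P A)" if "arc_set V A" for A
    using arc_set_image[OF p that] by (simp add: P_def range)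
  have Q: "arc_set V (Q B)" if "arc_set {1..N} B" for B
    using arc_set_image[OF q that] unfolding Q_def q_range .
  have cross: "has_k_crossing (P A) k \<longleftrightarrow> has_k_crossing A k" if "arc_set V A" for A k
    using has_k_crossing_image[OF p arc_set_subset[OF that], folded P_def]
      has_k_crossing_image[OF q arc_set_subset[OF P[OF that]], folded Q_def]
    unfolding QP[OF that] by blast
  have nest: "has_k_nesting (P A) k \<longleftrightarrow> has_k_nesting A k" if "arc_set V A" for A k
    using has_k_nesting_image[OF p arc_set_subset[OF that], folded P_def]
      has_k_nesting_image[OF q arc_set_subset[OF P[OF that]], folded Q_def]
    unfolding QP[OF that] by blast
  have tri: "arc_set {1..N} B \<longleftrightarrow> matching B \<and> B \<subseteq> triangle N" for B
    by (fastforce simp: arc_set_def triangle_def)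
  \<comment> \<open>The choice is forced by \<open>dual_unique\<close>; with \<open>dual_sym\<close>
    this makes \<open>D\<close> an involution.\<close>
  define D where "D B = (SOME B'. dual N B B')" for B
  have D: "dual N B (D B)" if "arc_set {1..N} B" for B
    unfolding D_def by (rule someI_ex) (use dual_exists that tri in blast)
  define T where "T A = Q (D (P A))" for A
  have "arc_set V (T A) \<and> T (T A) = A \<and> Domain (T A) = Domain A \<and> Range (T A) = Range A \<and>
    (\<forall>k. has_k_crossing (T A) k \<longleftrightarrow> has_k_nesting A k) \<and>
    (\<forall>k. has_k_nesting (T A) k \<longleftrightarrow> has_k_crossing A k)" if A: "arc_set V A" for A
  proof -
    have d: "dual N (P A) (D (P A))"
      using D P A by blast
    then have DP: "arc_set {1..N} (D (P A))"
      using dual_matching tri by blast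
    then have TA: "arc_set V (T A)"
      unfolding T_def by (rule Q)
    have PT: "P (T A) = D (P A)"
      unfolding T_def using PQ DP by blast
    then have "dual N (P (T A)) (P A)"
      using d dual_sym by simp
    then have "D (P (T A)) = P A"
      using D[OF P[OF TA]] dual_unique by blast
    then have TT: "T (T A) = A"
      unfolding T_def[of "T A"] using QP A by simp
    have "p ` Domain (T A) = Domain (P (T A))" "p ` Domain A = Domain (P A)"
      "p ` Range (T A) = Range (P (T A))" "p ` Range A = Range (P A)"
      by (force simp: P_def)+
    then have "p ` Domain (T A) = p ` Domain A" "p ` Range (T A) = p ` Range A"
      using dual_Domain_Range[OF d] PT by simp_all
    moreover have "Domain (T A) \<subseteq> V" "Domain A \<subseteq> V" "Range (T A) \<subseteq> V" "Range A \<subseteq> V"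
      using arc_set_subset[OF A] arc_set_subset[OF TA] by auto
    ultimately have "Domain (T A) = Domain A" "Range (T A) = Range A"
      by (simp_all add: inj_on_image_eq_iff[OF inj])
    moreover have "has_k_nesting (T A) k \<longleftrightarrow> has_k_crossing A k" for k
      using nest[OF TA] cross[OF A] dual_nesting_iff_crossing[OF d] PT by simp
    moreover have "has_k_crossing (T A) k \<longleftrightarrow> has_k_nesting A k" for k
      using nest[OF A] cross[OF TA] dual_nesting_iff_crossing[OF dual_sym[OF d]] PT by simp
    ultimately show ?thesis
      using TA TT by blast
  qed
  then show ?thesis by blast
qed

section \<open>Linked cycles\<close>

lemma set_eq_insert_hd_tl: "c \<noteq> [] \<Longrightarrow> set c = insert (hd c) (set (tl c))"
  by (cases c) auto

lemma in_set_tl_iff: "b \<in> set (tl c) \<longleftrightarrow> (\<exists>m. 0 < m \<and> m < length c \<and> c ! m = b)"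
proof (cases c)
  case (Cons a l)
  have "(\<exists>m. 0 < m \<and> m < Suc (length l) \<and> (a # l) ! m = b) \<longleftrightarrow> (\<exists>m<length l. l ! m = b)"
    by (metis Suc_less_eq gr0_conv_Suc nth_Cons_Suc zero_less_Suc)
  then show ?thesis
    using Cons by (simp add: in_set_conv_nth)
qed simp

text \<open>Near disjointness split along head and tail: heads are distinct, tails are disjoint, and
  an element covered twice heads one cycle, of size at least 2, and lies in the tail of
  another.\<close>

definition linked_list_cycle :: "nat \<Rightarrow> nat list set \<Rightarrow> bool" where
  "linked_list_cycle n C \<longleftrightarrow> finite C \<and>
     (\<forall>c\<in>C. c \<noteq> [] \<and> distinct c \<and> (\<forall>i\<in>set (tl c). hd c < i)) \<and>
     inj_on hd C \<and>
     (\<forall>c\<in>C. \<forall>d\<in>C. c \<noteq> d \<longrightarrow> set (tl c) \<inter> set (tl d) = {}) \<and>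
     (\<forall>c\<in>C. \<forall>d\<in>C. hd c \<in> set (tl d) \<longrightarrow> tl c \<noteq> []) \<and>
     (\<Union>c\<in>C. set c) = {1..n}"

lemma hd_less_tl_if_Min:
  fixes c :: "nat list"
  assumes "c \<noteq> []" "distinct c" "hd c = Min (set c)" "i \<in> set (tl c)"
  shows "hd c < i"
proof -
  have "hd c \<noteq> i"
    using assms by (cases c) auto
  moreover have "Min (set c) \<le> i"
    using assms set_eq_insert_hd_tl[of c] by (intro Min_le) auto
  ultimately show ?thesis
    using assms(3) by simp
qed

lemma Min_if_hd_less_tl:
  fixes c :: "nat list"
  assumes "c \<noteq> []" "\<forall>i\<in>set (tl c). hd c < i"
  shows "Min (set c) = hd c"
  using assms set_eq_insert_hd_tl[of c] by (intro Min_eqI) auto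

lemma card_set_gt_one_iff: "c \<noteq> [] \<Longrightarrow> distinct c \<Longrightarrow> 1 < card (set c) \<longleftrightarrow> tl c \<noteq> []"
  by (cases c) (auto simp: card_gt_0_iff)

lemma linked_list_cycle_if_linked_cycle:
  assumes "linked_cycle n C"
  shows "linked_list_cycle n C"
proof -
  have fin: "finite C" and c: "\<And>c. c \<in> C \<Longrightarrow> c \<noteq> [] \<and> distinct c \<and> hd c = Min (set c)"
    and inj: "inj_on set C" and U: "\<Union>(set ` C) = {1..n}"
    and nd: "\<And>c d. c \<in> C \<Longrightarrow> d \<in> C \<Longrightarrow> set c \<noteq> set d \<Longrightarrow> nearly_disjoint (set c) (set d)"
    using assms unfolding linked_cycle_def linked_partition_def by auto
  have lt: "hd c < i" if "c \<in> C" "i \<in> set (tl c)" for c i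
    using hd_less_tl_if_Min c that by blast
  have near: "i = hd c \<and> tl c \<noteq> [] \<and> i \<noteq> hd d \<or> i = hd d \<and> tl d \<noteq> [] \<and> i \<noteq> hd c"
    if "c \<in> C" "d \<in> C" "c \<noteq> d" "i \<in> set c" "i \<in> set d" for c d i
    using nd[of c d] that inj_onD[OF inj] c[of c] c[of d] card_set_gt_one_iff[of c] card_set_gt_one_iff[of d]
    unfolding nearly_disjoint_def by (metis IntI)
  have mem: "hd c \<in> set c" "i \<in> set (tl c) \<Longrightarrow> i \<in> set c" if "c \<in> C" for c i
    using set_eq_insert_hd_tl[of c] c[OF that] by auto
  show ?thesis
    unfolding linked_list_cycle_def
  proof (intro conjI ballI impI fin)
    show "inj_on hd C"
      by (rule inj_onI) (metis near mem(1))
    fix a b assume ab: "a \<in> C" "b \<in> C"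
    show "set (tl a) \<inter> set (tl b) = {}" if "a \<noteq> b"
      using near[OF ab that] lt ab mem by (metis disjoint_iff less_irrefl)
    show "tl a \<noteq> []" if "hd a \<in> set (tl b)"
    proof (cases "a = b")
      case False
      then show ?thesis
        using near[OF ab False, of "hd a"] mem ab that lt by blast
    qed (use that in auto)
  qed (use c lt U in auto)
qed

lemma linked_cycle_if_linked_list_cycle:
  assumes "linked_list_cycle n C"
  shows "linked_cycle n C"
proof -
  have fin: "finite C" and c: "\<And>c. c \<in> C \<Longrightarrow> c \<noteq> [] \<and> distinct c \<and> (\<forall>i\<in>set (tl c). hd c < i)"
    and inj: "inj_on hd C" and U: "(\<Union>c\<in>C. set c) = {1..n}"
    and dis: "\<And>c d. c \<in> C \<Longrightarrow> d \<in> C \<Longrightarrow> c \<noteq> d \<Longrightarrow> set (tl c) \<inter> set (tl d) = {}"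
    and tl: "\<And>c d. c \<in> C \<Longrightarrow> d \<in> C \<Longrightarrow> hd c \<in> set (tl d) \<Longrightarrow> tl c \<noteq> []"
    using assms unfolding linked_list_cycle_def by auto
  have Min: "Min (set c) = hd c" if "c \<in> C" for c
    using Min_if_hd_less_tl c[OF that] by blast
  have mem: "i \<in> set c \<longleftrightarrow> i = hd c \<or> i \<in> set (tl c)" if "c \<in> C" for c i
    using set_eq_insert_hd_tl[of c] c[OF that] by auto
  have inj_set: "inj_on set C"
    by (rule inj_onI) (metis Min inj inj_onD)
  have "nearly_disjoint (set c) (set d)" if cd: "c \<in> C" "d \<in> C" "set c \<noteq> set d" for c d
    unfolding nearly_disjoint_def
  proof
    fix i assume i: "i \<in> set c \<inter> set d"
    have ne: "hd c \<noteq> hd d" using inj_onD[OF inj _ cd(1,2)] cd(3) by auto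
    have "i \<notin> set (tl c) \<or> i \<notin> set (tl d)" using dis[OF cd(1,2)] cd(3) by blast
    then have "i = hd c \<and> i \<in> set (tl d) \<or> i = hd d \<and> i \<in> set (tl c)"
      using i mem[OF cd(1), of i] mem[OF cd(2), of i] ne by auto
    moreover have "1 < card (set c) \<longleftrightarrow> tl c \<noteq> []" "1 < card (set d) \<longleftrightarrow> tl d \<noteq> []"
      using card_set_gt_one_iff c cd by blast+
    ultimately show "i = Min (set c) \<and> 1 < card (set c) \<and> i \<noteq> Min (set d) \<or>
         i = Min (set d) \<and> 1 < card (set d) \<and> i \<noteq> Min (set c)"
      using tl[OF cd(1,2)] tl[OF cd(2,1)] Min[OF cd(1)] Min[OF cd(2)] ne by auto
  qed
  \<comment> \<open>An element heads at most one cycle and lies in at most one tail, which bounds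
    the cover by 2.\<close>
  moreover have "card {B \<in> set ` C. i \<in> B} \<in> {1, 2}" if i: "i \<in> {1..n}" for i
  proof -
    let ?H = "{c \<in> C. hd c = i}" and ?T = "{c \<in> C. i \<in> set (tl c)}"
    have "{c \<in> C. i \<in> set c} = ?H \<union> ?T"
      by (auto simp: mem)
    then have eq: "{B \<in> set ` C. i \<in> B} = set ` (?H \<union> ?T)"
      by blast
    have "card ?H \<le> 1"
      using inj by (auto simp: card_le_Suc0_iff_eq fin inj_on_def)
    moreover have "card ?T \<le> 1"
      using dis by (force simp: card_le_Suc0_iff_eq fin)
    ultimately have "card (?H \<union> ?T) \<le> 2"
      using card_Un_le[of ?H ?T] by linarith
    then have "card {B \<in> set ` C. i \<in> B} \<le> 2"
      unfolding eq using card_image_le[of "?H \<union> ?T" set] fin by simp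
    moreover have "\<exists>c\<in>C. i \<in> set c" using i U by blast
    then have "card {B \<in> set ` C. i \<in> B} \<noteq> 0"
      using fin by auto
    ultimately show ?thesis by auto
  qed
  ultimately show ?thesis
    unfolding linked_cycle_def linked_partition_def using fin c Min inj_set U by auto
qed

lemma linked_cycle_iff: "linked_cycle n C \<longleftrightarrow> linked_list_cycle n C"
  using linked_list_cycle_if_linked_cycle linked_cycle_if_linked_list_cycle by blast

section \<open>Vertices and arcs of the linear representation\<close>

lemma lr_arcs_iff:
  "((i, j), v) \<in> lr_arcs C \<longleftrightarrow> (\<exists>c\<in>C. hd c = i \<and> 0 < j \<and> j < length c \<and> v = (c ! (length c - j), 0))"
proof -
  have "2 \<le> length c \<and> 1 \<le> j \<and> j \<le> length c - 1 \<longleftrightarrow> 0 < j \<and> j < length c" for c :: "nat list"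
    by auto
  then show ?thesis
    unfolding lr_arcs_def by auto
qed

text \<open>Openers record the heads and lengths of the cycles with at least two elements, closers
  (\<open>Range_lr_arcs\<close>) the union of the tails. Only the assignment of closers to openers
  is left free.\<close>

lemma Domain_lr_arcs: "(i, j) \<in> Domain (lr_arcs C) \<longleftrightarrow> (\<exists>c\<in>C. hd c = i \<and> 0 < j \<and> j < length c)"
  unfolding Domain_iff lr_arcs_iff by auto

lemma Range_lr_arcs: "(b, k) \<in> Range (lr_arcs C) \<longleftrightarrow> k = 0 \<and> (\<exists>c\<in>C. b \<in> set (tl c))"
proof -
  have "(b, k) \<in> Range (lr_arcs C) \<longleftrightarrow>
      (\<exists>c\<in>C. \<exists>j. 0 < j \<and> j < length c \<and> (b, k) = (c ! (length c - j), 0))"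
    unfolding Range_iff split_paired_Ex lr_arcs_iff by auto
  also have "\<dots> \<longleftrightarrow> k = 0 \<and> (\<exists>c\<in>C. b \<in> set (tl c))"
  proof -
    have "(\<exists>j. 0 < j \<and> j < length c \<and> b = c ! (length c - j)) \<longleftrightarrow> b \<in> set (tl c)" for c
    proof
      assume "\<exists>j. 0 < j \<and> j < length c \<and> b = c ! (length c - j)"
      then obtain j where "0 < j" "j < length c" "b = c ! (length c - j)" by blast
      then show "b \<in> set (tl c)"
        unfolding in_set_tl_iff by (intro exI[of _ "length c - j"]) auto
    next
      assume "b \<in> set (tl c)"
      then obtain m where "0 < m" "m < length c" "c ! m = b"
        unfolding in_set_tl_iff by blast
      then show "\<exists>j. 0 < j \<and> j < length c \<and> b = c ! (length c - j)"
        by (intro exI[of _ "length c - m"]) auto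
    qed
    then show ?thesis by auto
  qed
  finally show ?thesis .
qed

context
  fixes n C
  assumes C: "linked_list_cycle n C"
begin

lemma llc_cycle: "c \<in> C \<Longrightarrow> c \<noteq> [] \<and> distinct c \<and> (\<forall>i\<in>set (tl c). hd c < i)"
  and llc_finite: "finite C"
  and llc_hd_inj: "c \<in> C \<Longrightarrow> d \<in> C \<Longrightarrow> hd c = hd d \<Longrightarrow> c = d"
  and llc_Union: "(\<Union>c\<in>C. set c) = {1..n}"
  using C unfolding linked_list_cycle_def inj_on_def by simp_all

lemma llc_tl: "c \<in> C \<Longrightarrow> d \<in> C \<Longrightarrow> hd c \<in> set (tl d) \<Longrightarrow> tl c \<noteq> []"
  using C unfolding linked_list_cycle_def by blast

lemma llc_tl_inj:
  assumes "c \<in> C" "d \<in> C" "i \<in> set (tl c)" "i \<in> set (tl d)"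
  shows "c = d"
proof (rule ccontr)
  assume "c \<noteq> d"
  then have "set (tl c) \<inter> set (tl d) = {}"
    using C assms(1,2) unfolding linked_list_cycle_def by simp
  then show False using assms(3,4) by blast
qed

lemma llc_mem: "c \<in> C \<Longrightarrow> i \<in> set c \<longleftrightarrow> i = hd c \<or> i \<in> set (tl c)"
  using llc_cycle[of c] set_eq_insert_hd_tl[of c] by auto

text \<open>Four cases, by whether i heads a cycle and whether it lies in a tail; the cover count is
  2 exactly when both hold. The alternative \<open>j = 1\<close> supplies the isolated vertex of a
  singleton. In the doubly covered case \<open>llc_tl\<close> gives length at least 2, so that
  \<open>j = 1\<close> agrees with \<open>j < length c\<close>.\<close>

lemma lr_vertices_iff:
  "(i, j) \<in> lr_vertices n C \<longleftrightarrow> (j = 0 \<and> (\<exists>c\<in>C. i \<in> set (tl c))) \<or>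
     (0 < j \<and> (\<exists>c\<in>C. hd c = i \<and> (j = 1 \<or> j < length c)))"
proof -
  consider (both) c d where "c \<in> C" "hd c = i" "d \<in> C" "i \<in> set (tl d)"
    | (head) c where "c \<in> C" "hd c = i" "\<forall>d\<in>C. i \<notin> set (tl d)"
    | (tail) d where "d \<in> C" "i \<in> set (tl d)" "\<forall>c\<in>C. hd c \<noteq> i"
    | (none) "\<forall>d\<in>C. i \<notin> set (tl d)" "\<forall>c\<in>C. hd c \<noteq> i"
    by blast
  then show ?thesis
  proof cases
    case both
    have i: "i \<in> {1..n}"
      unfolding llc_Union[symmetric] using both llc_mem by blast
    have cd: "c \<noteq> d" using both llc_cycle[of d] by auto
    have "{e \<in> C. i \<in> set e} = {c, d}"
      using both llc_mem llc_hd_inj llc_tl_inj by blast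
    then have cov: "cover_count C i = 2"
      using cd by (simp add: cover_count_def)
    have hd: "(\<exists>e\<in>C. hd e = i \<and> P e) \<longleftrightarrow> P c" for P
      using both llc_hd_inj by blast
    have "tl c \<noteq> []" using llc_tl both by blast
    then have "2 \<le> length c" by (cases c; cases "tl c") auto
    then show ?thesis
      unfolding lr_vertices_def using i both cov by (auto simp: hd)
  next
    case head
    have i: "i \<in> {1..n}"
      unfolding llc_Union[symmetric] using head llc_mem by blast
    have e: "e \<in> C \<and> i \<in> set e \<longleftrightarrow> e = c" for e
      using head llc_mem llc_hd_inj by blast
    then have cov: "cover_count C i = 1"
      by (simp add: cover_count_def)
    have the: "(THE e. e \<in> C \<and> i \<in> set e) = c"
      by (simp add: e)
    have hd: "(\<exists>e\<in>C. hd e = i \<and> P e) \<longleftrightarrow> P c" for P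
      using head llc_hd_inj by blast
    have hd': "\<exists>e\<in>C. hd e = i" using head by blast
    have "c \<noteq> []" using head llc_cycle by blast
    then have "1 \<le> length c" by (cases c) auto
    then show ?thesis
      unfolding lr_vertices_def using i head(3) by (auto simp: cov the hd hd' Let_def)
  next
    case tail
    have i: "i \<in> {1..n}"
      unfolding llc_Union[symmetric] using tail llc_mem by blast
    have e: "e \<in> C \<and> i \<in> set e \<longleftrightarrow> e = d" for e
      using tail llc_mem llc_tl_inj by metis
    then have cov: "cover_count C i = 1"
      by (simp add: cover_count_def)
    show ?thesis
      unfolding lr_vertices_def using i tail by (auto simp: cov)
  next
    case none
    then have "i \<notin> {1..n}"
      unfolding llc_Union[symmetric] by (auto simp: llc_mem)
    then show ?thesis
      unfolding lr_vertices_def using none by auto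
  qed
qed

lemma finite_lr_vertices: "finite (lr_vertices n C)"
proof -
  have "lr_vertices n C \<subseteq> (\<Union>c\<in>C. set c \<times> {..Suc (length c)})"
  proof
    fix v assume "v \<in> lr_vertices n C"
    then show "v \<in> (\<Union>c\<in>C. set c \<times> {..Suc (length c)})"
      using llc_mem by (cases v) (fastforce simp: lr_vertices_iff)
  qed
  then show ?thesis
    by (rule finite_subset) (simp add: llc_finite)
qed

lemma set_vertex_labeling: "set (vertex_labeling n C) = lr_vertices n C"
  using finite_lr_vertices by (simp add: vertex_labeling_def)

text \<open>An opener determines its cycle by the head and the entry by the superscript; a closer
  lies in a single tail and, the cycle being distinct, at a single position.\<close>

lemma arc_set_lr_arcs: "arc_set (lr_vertices n C) (lr_arcs C)"
proof -
  have sv: "single_valued (lr_arcs C)"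
    unfolding single_valued_def split_paired_All lr_arcs_iff using llc_hd_inj by blast
  have "(i, j) = (i', j')" if arcs: "((i, j), v) \<in> lr_arcs C" "((i', j'), v) \<in> lr_arcs C" for i j i' j' v
  proof -
    obtain c where c: "c \<in> C" "hd c = i" "0 < j" "j < length c" "v = (c ! (length c - j), 0)"
      using arcs(1) unfolding lr_arcs_iff by blast
    obtain d where d: "d \<in> C" "hd d = i'" "0 < j'" "j' < length d" "v = (d ! (length d - j'), 0)"
      using arcs(2) unfolding lr_arcs_iff by blast
    have "c ! (length c - j) \<in> set (tl c)" "d ! (length d - j') \<in> set (tl d)"
      unfolding in_set_tl_iff using c(3,4) d(3,4)
      by (intro exI[of _ "length c - j"] exI[of _ "length d - j'"]; simp)+
    then have cd: "c = d"
      using llc_tl_inj c d by simp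
    then have "length c - j = length c - j'"
      using c d llc_cycle[OF c(1)] nth_eq_iff_index_eq[of c "length c - j" "length c - j'"] by simp
    then show ?thesis using c d cd by simp
  qed
  then have sv': "single_valued ((lr_arcs C)\<inverse>)"
    unfolding single_valued_def by auto
  have "u \<in> lr_vertices n C \<and> v \<in> lr_vertices n C \<and> u < v" if uv: "(u, v) \<in> lr_arcs C" for u v
  proof -
    obtain i j where u: "u = (i, j)" by (cases u)
    obtain c where c: "c \<in> C" "hd c = i" "0 < j" "j < length c" "v = (c ! (length c - j), 0)"
      using uv unfolding u lr_arcs_iff by blast
    have m: "c ! (length c - j) \<in> set (tl c)"
      unfolding in_set_tl_iff using c(3,4) by (intro exI[of _ "length c - j"]) simp
    then have "hd c < c ! (length c - j)"
      using llc_cycle[OF c(1)] by blast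
    then show ?thesis
      using c m unfolding u c(5) lr_vertices_iff by (auto simp: less_prod_def)
  qed
  then show ?thesis
    using sv sv' unfolding arc_set_def matching_def by blast
qed

end

text \<open>
  The head and the length of each cycle are kept; the remaining entries are read off the arcs that
  leave its head.
\<close>

lemma linked_cycle_of_arcs:
  assumes C: "linked_list_cycle n C" and A: "arc_set V A" and dom: "Domain A = Domain (lr_arcs C)" and ran: "Range A = Range (lr_arcs C)"
  shows "\<exists>D. linked_list_cycle n D \<and> lr_arcs D = A \<and> lr_vertices n D = lr_vertices n C"
proof -
  define partner where "partner u = (SOME v. (u, v) \<in> A)" for u
  \<comment> \<open>The superscripts run against the cycle: entry m, counted from 0, is the partner
    of superscript \<open>length c - m\<close>.\<close>
  define f where "f c = hd c # map (\<lambda>m. fst (partner (hd c, length c - m))) [1..<length c]" for c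
  have sv: "(u, v) \<in> A \<Longrightarrow> (u, v') \<in> A \<Longrightarrow> v = v'" and sv': "(u, v) \<in> A \<Longrightarrow> (u', v) \<in> A \<Longrightarrow> u = u'"
    for u u' v v'
    using A unfolding arc_set_def matching_def single_valued_def by blast+
  have hd_f: "hd (f c) = hd c" for c
    by (simp add: f_def)
  have len_f: "length (f c) = length c" if "c \<in> C" for c
    using llc_cycle[OF C that] by (cases c) (simp_all add: f_def del: upt_Suc)
  have arc: "((hd c, length c - m), (f c ! m, 0)) \<in> A" if c: "c \<in> C" "0 < m" "m < length c" for c m
  proof -
    have "(hd c, length c - m) \<in> Domain A"
      unfolding dom Domain_lr_arcs using c by auto
    then have p: "((hd c, length c - m), partner (hd c, length c - m)) \<in> A"
      unfolding partner_def by (auto intro: someI)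
    \<comment> \<open>Since the closers are the same as for \<open>C\<close>, the partner has
      superscript 0 and \<open>fst\<close> loses no information.\<close>
    then have "partner (hd c, length c - m) \<in> Range (lr_arcs C)"
      unfolding ran[symmetric] by blast
    then have "snd (partner (hd c, length c - m)) = 0"
      using Range_lr_arcs[of "fst (partner (hd c, length c - m))" "snd (partner (hd c, length c - m))" C]
      by simp
    moreover have "f c ! m = fst (partner (hd c, length c - m))"
      using c unfolding f_def by (cases m) auto
    ultimately show ?thesis
      using p by (metis prod.collapse)
  qed
  let ?D = "f ` C"
  have arcs: "lr_arcs ?D = A"
  proof (intro set_eqI iffI)
    fix e assume "e \<in> lr_arcs ?D"
    then obtain i j v where e: "e = ((i, j), v)" "((i, j), v) \<in> lr_arcs ?D"
      by (cases e; cases "fst e") auto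
    then obtain c where "c \<in> C" "hd c = i" "0 < j" "j < length c" "v = (f c ! (length c - j), 0)"
      unfolding lr_arcs_iff using hd_f len_f by auto
    then show "e \<in> A"
      using arc[of c "length c - j"] e by simp
  next
    fix e assume eA: "e \<in> A"
    obtain i j v where e: "e = ((i, j), v)"
      by (cases e; cases "fst e") auto
    then have "(i, j) \<in> Domain (lr_arcs C)"
      using eA dom by blast
    then obtain c where c: "c \<in> C" "hd c = i" "0 < j" "j < length c"
      unfolding Domain_lr_arcs by blast
    then have "v = (f c ! (length c - j), 0)"
      using sv[OF arc[of c "length c - j"]] eA e by simp
    then show "e \<in> lr_arcs ?D"
      unfolding e lr_arcs_iff using c hd_f len_f by auto
  qed
  then have tails: "(\<exists>d\<in>?D. b \<in> set (tl d)) \<longleftrightarrow> (\<exists>c\<in>C. b \<in> set (tl c))" for b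
    using Range_lr_arcs[of b 0 ?D] Range_lr_arcs[of b 0 C] ran by simp
  have tl_arc: "\<exists>j. 0 < j \<and> j < length c \<and> ((hd c, j), (b, 0)) \<in> A" if cb: "c \<in> C" "b \<in> set (tl (f c))" for c b
  proof -
    obtain m where "0 < m" "m < length c" "f c ! m = b"
      using cb unfolding in_set_tl_iff by (auto simp: len_f)
    then show ?thesis
      using arc[of c m] cb by (intro exI[of _ "length c - m"]) auto
  qed
  have D: "linked_list_cycle n ?D"
    unfolding linked_list_cycle_def
  proof (intro conjI)
    show "finite ?D" using llc_finite[OF C] by simp
    show "inj_on hd ?D"
      by (rule inj_onI) (metis llc_hd_inj[OF C] hd_f imageE)
    show "\<forall>d\<in>?D. d \<noteq> [] \<and> distinct d \<and> (\<forall>i\<in>set (tl d). hd d < i)"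
    proof
      fix d assume "d \<in> ?D"
      then obtain c where c: "c \<in> C" "d = f c" by blast
      have lt: "hd d < i" if i: "i \<in> set (tl d)" for i
      proof -
        obtain j where "0 < j" "((hd c, j), (i, 0)) \<in> A"
          using tl_arc[OF c(1), of i] i c(2) by auto
        \<comment> \<open>In the lexicographic order a positive j excludes \<open>hd c = i\<close>,
          so the head is strictly smaller.\<close>
        then have "(hd c, j) < (i, 0)"
          using A unfolding arc_set_def by blast
        then show ?thesis
          using \<open>0 < j\<close> c hd_f by (auto simp: less_prod_def)
      qed
      have "d ! m \<noteq> d ! m'" if "m < m'" "m' < length d" for m m'
      proof (cases "m = 0")
        case True
        have "d ! m' \<in> set (tl d)"
          unfolding in_set_tl_iff using that by (intro exI[of _ m']) auto
        moreover have "d ! 0 = hd d"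
          using that by (cases d) auto
        ultimately show ?thesis
          using lt True by force
      next
        case False
        have len: "length d = length c" using c len_f by simp
        show ?thesis
        proof
          assume "d ! m = d ! m'"
          then have "(hd c, length c - m) = (hd c, length c - m')"
            using sv'[OF arc[OF c(1), of m]] arc[OF c(1), of m'] that False len c(2) by simp
          then show False using that len by auto
        qed
      qed
      then have "distinct d"
        unfolding distinct_conv_nth by (metis linorder_neqE_nat)
      then show "d \<noteq> [] \<and> distinct d \<and> (\<forall>i\<in>set (tl d). hd d < i)"
        using lt c by (auto simp: f_def)
    qed
    show "\<forall>c\<in>?D. \<forall>d\<in>?D. c \<noteq> d \<longrightarrow> set (tl c) \<inter> set (tl d) = {}"
    proof (intro ballI impI)
      fix d d' assume "d \<in> ?D" "d' \<in> ?D" "d \<noteq> d'"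
      then obtain c c' where c: "c \<in> C" "c' \<in> C" "d = f c" "d' = f c'" "c \<noteq> c'" by blast
      have False if "b \<in> set (tl (f c))" "b \<in> set (tl (f c'))" for b
        using tl_arc[OF c(1) that(1)] tl_arc[OF c(2) that(2)] sv' llc_hd_inj[OF C c(1,2)] c(5) by blast
      then show "set (tl d) \<inter> set (tl d') = {}" using c by blast
    qed
    show "\<forall>c\<in>?D. \<forall>d\<in>?D. hd c \<in> set (tl d) \<longrightarrow> tl c \<noteq> []"
    proof (intro ballI impI)
      fix d d' assume d: "d \<in> ?D" "d' \<in> ?D" "hd d \<in> set (tl d')"
      then obtain c where c: "c \<in> C" "d = f c" by blast
      have "\<exists>c'\<in>C. hd c \<in> set (tl c')"
        using tails d c hd_f by auto
      then have "tl c \<noteq> []" using llc_tl[OF C] c by blast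
      moreover have "length (tl d) = length (tl c)" using c len_f by simp
      ultimately show "tl d \<noteq> []" by (metis length_0_conv)
    qed
    have "i \<in> (\<Union>d\<in>?D. set d) \<longleftrightarrow> i \<in> (\<Union>c\<in>C. set c)" for i
    proof -
      have "i \<in> (\<Union>d\<in>?D. set d) \<longleftrightarrow> (\<exists>c\<in>C. i = hd c) \<or> (\<exists>d\<in>?D. i \<in> set (tl d))"
      proof -
        have "set (f c) = insert (hd c) (set (tl (f c)))" for c
          by (simp add: f_def)
        then show ?thesis by auto
      qed
      also have "\<dots> \<longleftrightarrow> (\<exists>c\<in>C. i = hd c) \<or> (\<exists>c\<in>C. i \<in> set (tl c))"
        by (simp only: tails)
      also have "\<dots> \<longleftrightarrow> i \<in> (\<Union>c\<in>C. set c)"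
        by (auto simp: llc_mem[OF C])
      finally show ?thesis .
    qed
    then have "(\<Union>d\<in>?D. set d) = (\<Union>c\<in>C. set c)"
      by (rule set_eqI)
    then show "(\<Union>d\<in>?D. set d) = {1..n}"
      unfolding llc_Union[OF C] .
  qed
  have heads: "(\<exists>d\<in>?D. hd d = i \<and> P (length d)) \<longleftrightarrow> (\<exists>c\<in>C. hd c = i \<and> P (length c))" for i P
    using hd_f len_f by auto
  have "lr_vertices n ?D = lr_vertices n C"
  proof (rule set_eqI)
    fix v
    show "v \<in> lr_vertices n ?D \<longleftrightarrow> v \<in> lr_vertices n C"
      using heads[of "fst v" "\<lambda>l. snd v = 1 \<or> snd v < l"] tails[of "fst v"]
      by (cases v) (simp only: lr_vertices_iff[OF C] lr_vertices_iff[OF D] fst_conv snd_conv)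
  qed
  then show ?thesis
    using D arcs by blast
qed

text \<open>Every head i shows as a vertex \<open>(i, 1)\<close>, even that of a singleton, which
  has no arcs. The arcs leaving the head then give the length and the entries. The inclusion is used
  in both directions.\<close>

lemma linked_cycle_determined:
  assumes C: "linked_list_cycle n C" and D: "linked_list_cycle n D"
    and arcs: "lr_arcs C = lr_arcs D" and verts: "lr_vertices n C = lr_vertices n D"
  shows "C \<subseteq> D"
proof
  fix c assume c: "c \<in> C"
  have "(hd c, 1) \<in> lr_vertices n C"
    unfolding lr_vertices_iff[OF C] using c by auto
  then obtain d where d: "d \<in> D" "hd d = hd c"
    unfolding verts lr_vertices_iff[OF D] by auto
  have len: "j < length c \<longleftrightarrow> j < length d" if "0 < j" for j
  proof -
    have "j < length c \<longleftrightarrow> (hd c, j) \<in> Domain (lr_arcs C)"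
      unfolding Domain_lr_arcs using llc_hd_inj[OF C] c that by blast
    also have "\<dots> \<longleftrightarrow> j < length d"
      unfolding arcs Domain_lr_arcs using llc_hd_inj[OF D] d that by metis
    finally show ?thesis .
  qed
  have ne: "c \<noteq> []" "d \<noteq> []"
    using llc_cycle[OF C c] llc_cycle[OF D d(1)] by auto
  have length: "length c = length d"
    by (rule eq_if_less_iff) (metis len ne gr0I length_greater_0_conv)
  have "c = d"
  proof (rule nth_equalityI[OF length])
    fix m assume m: "m < length c"
    show "c ! m = d ! m"
    proof (cases "m = 0")
      case True
      then show ?thesis using d ne by (simp add: hd_conv_nth)
    next
      case False
      then have "((hd c, length c - m), (c ! m, 0)) \<in> lr_arcs D"
        unfolding arcs[symmetric] lr_arcs_iff using c m by (intro bexI[of _ c]) auto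
      then obtain d' where d': "d' \<in> D" "hd d' = hd c" "c ! m = d' ! (length d' - (length c - m))"
        unfolding lr_arcs_iff by auto
      then have "d' = d" using llc_hd_inj[OF D] d by simp
      then show ?thesis using d' m length by simp
    qed
  qed
  then show "c \<in> D" using d by simp
qed

section \<open>Transfer of the involution to linked cycles\<close>

theorem theorem4p11:
  fixes n :: nat and L :: "(nat \<times> nat) list" and x y :: "'a :: comm_semiring_1"
  assumes "n \<ge> 1"
    and "\<exists>C. linked_cycle n C \<and> vertex_labeling n C = L"
  shows "(\<Sum>C \<in> LC n L. x ^ cr C * y ^ ne C) = (\<Sum>C \<in> LC n L. x ^ ne C * y ^ cr C)"
proof -
  from crossing_nesting_involution[OF finite_set[of L]]
  obtain T where "\<forall>A. arc_set (set L) A \<longrightarrow> arc_set (set L) (T A) \<and> T (T A) = A \<and>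
    Domain (T A) = Domain A \<and> Range (T A) = Range A \<and>
    (\<forall>k. has_k_crossing (T A) k \<longleftrightarrow> has_k_nesting A k) \<and>
    (\<forall>k. has_k_nesting (T A) k \<longleftrightarrow> has_k_crossing A k)"
    by (rule exE)
  note T = this[rule_format]
  have LC: "linked_list_cycle n C" "lr_vertices n C = set L" "arc_set (set L) (lr_arcs C)"
    if "C \<in> LC n L" for C
  proof -
    show llc: "linked_list_cycle n C" and "lr_vertices n C = set L"
      using that linked_cycle_iff set_vertex_labeling by (auto simp: LC_def)
    then show "arc_set (set L) (lr_arcs C)"
      using arc_set_lr_arcs by metis
  qed
  have inj: "C = D" if "C \<in> LC n L" "D \<in> LC n L" "lr_arcs C = lr_arcs D" for C D
    using linked_cycle_determined[of n C D] linked_cycle_determined[of n D C] LC that by auto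
  \<comment> \<open>\<open>inj\<close> makes the chosen cycle unique, so \<open>F\<close> inherits
    the involution property from \<open>T\<close>.\<close>
  define F where "F C = (SOME D. D \<in> LC n L \<and> lr_arcs D = T (lr_arcs C))" for C
  have F: "F C \<in> LC n L \<and> lr_arcs (F C) = T (lr_arcs C)" if C: "C \<in> LC n L" for C
    unfolding F_def
  proof (rule someI_ex)
    obtain D where "linked_list_cycle n D" "lr_arcs D = T (lr_arcs C)" "lr_vertices n D = lr_vertices n C"
      using linked_cycle_of_arcs[OF LC(1)[OF C], of "set L" "T (lr_arcs C)"] T[OF LC(3)[OF C]] by blast
    moreover from this have "D \<in> LC n L"
      using C unfolding LC_def vertex_labeling_def linked_cycle_iff by simp
    ultimately show "\<exists>D. D \<in> LC n L \<and> lr_arcs D = T (lr_arcs C)" by blast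
  qed
  have FF: "F (F C) = C" if C: "C \<in> LC n L" for C
    using inj[of "F (F C)" C] F[OF C] F[of "F C"] T[OF LC(3)[OF C]] C by simp
  show ?thesis
  proof (rule sum.reindex_bij_witness[where i = F and j = F])
    fix C assume C: "C \<in> LC n L"
    have "has_k_nesting (lr_arcs (F C)) = has_k_crossing (lr_arcs C)"
      "has_k_crossing (lr_arcs (F C)) = has_k_nesting (lr_arcs C)"
      using F[OF C] T[OF LC(3)[OF C]] by (simp_all add: fun_eq_iff)
    then have "ne (F C) = cr C" "cr (F C) = ne C"
      unfolding ne_def cr_def by simp_all
    then show "x ^ ne (F C) * y ^ cr (F C) = x ^ cr C * y ^ ne C" by simp
  qed (use F FF in auto)
qed

end
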